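(* With the vertex set of the twisted quiver identified with $\overline I^{\mathrm{tw},\flat}_\xi$, there exists a $\mathbb Z$-algebra isomorphism $\widetilde\Phi^T\colon\mathcal T_{\mathcal Q^\flat}\to\mathcal Y_{t,\mathcal Q^\flat}$ given by \[ v^{\pm1/2}\mapsto t^{\mp1/2},\qquad X_{(i,r)}\mapsto\underline{m^{(i)}_{k(i,r),r}}=\underline{\prod_{s=1}^{k(i,r)}Y_{i,r+2r_i(s-1)}} \] for $(i,r)\in\overline I^{\mathrm{tw},\flat}_\xi$. Moreover $\widetilde\Phi^T\circ\overline{(\cdot)}=\overline{(\cdot)}\circ\widetilde\Phi^T$. Here, on $\mathcal T_{\mathcal Q^\flat}$, the map $\overline{(\cdot)}$ is the $\mathbb Z$-linear anti-involution $v^{r/2}X^{\bm c}\mapsto v^{-r/2}X^{\bm c}$.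
   Context: Type $\mathrm B_n$ data. Fix $n\ge2$; $I=\{1,\dots,n\}$, type $\mathrm B_n$ with $\alpha_n$ short. The Cartan matrix $c_{ij}=\langle h_i,\alpha_j\rangle$ has $c_{ii}=2$, $c_{i,i\pm1}=-1$ except $c_{n,n-1}=-2$, and $0$ otherwise; $r_i=2$ for $i<n$ and $r_n=1$. $\mathcal Y=\mathbb Z[Y_{i,r}^{\pm1}\mid i\in I,r\in\mathbb Z]$. Quantum torus. Let $C(z)$ be the matrix with $C(z)_{ii}=z^{r_i}+z^{-r_i}$ and $C(z)_{ij}=(z^{c_{ij}}-z^{-c_{ij}})/(z-z^{-1})$ for $i\neq j$, and expand $C(z)^{-1}_{ji}=\sum_r\tilde c_{ji}(r)z^r$ in $\mathbb Z((z^{-1}))$. $\mathcal Y_t$ is the $\mathbb Z$-algebra generated by central $t^{\pm1/2}$ and invertible $\widetilde Y_{i,r}$ with $\widetilde Y_{i,r}\widetilde Y_{j,s}=t^{\gamma(i,r;j,s)}\widetilde Y_{j,s}\widetilde Y_{i,r}$, where \[ \gamma(i,r;j,s)=\tilde c_{ji}(-r_j-r+s)+\tilde c_{ji}(r_j+r-s)-\tilde c_{ji}(r_j-r+s)-\tilde c_{ji}(-r_j+r-s). \] The bar anti-involution of $\mathcal Y_t$ is $t^{1/2}\mapsto t^{-1/2}$, $\widetilde Y_{i,r}\mapsto t^{-1}\widetilde Y_{i,r}$. For a monomial $m$ in $\mathcal Y$, $\underline m$ is the unique bar-invariant element $t^{a/2}\widetilde Y_{i_1,r_1}^{\pm1}\cdots\widetilde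 Y_{i_k,r_k}^{\pm1}$ specializing (via $t^{1/2}\mapsto1$, $\widetilde Y\mapsto Y$) to $m$. Twisted set. Let $\mathcal Q$ be a quiver of type $\mathrm A_{2n-2}$ (vertices $1,\dots,2n-2$), and $\xi$ a height function: $\xi(j)=\xi(i)+1$ for each arrow $i\to j$. Let $\widehat I_\xi=\{(i,p):1\le i\le2n-2,\ p\equiv\xi(i)\ (\mathrm{mod}\ 2),\ \xi(2n-1-i)-(2n-1)<p\le\xi(i)\}$, and fix $\flat\in\{>,<\}$. $\widehat I^{\mathrm{tw},\flat}_\xi\subset\{1,\dots,2n-1\}\times\frac12\mathbb Z$ is the union of: - $(i,p)$ for $(i,p)\in\widehat I_\xi$ with $i\le n-1$; - $(i+1,p)$ for $(i,p)\in\widehat I_\xi$ with $i\ge n$; - $(n,p-\frac12)$ whenever $\{(n-1,p-1),(n,p)\}\subset\widehat I_\xi$ or $\{(n,p-1),(n-1,p)\}\subset\widehat I_\xi$; - $(n,r_M+\frac12)$ if $\flat={>}$, or $(n,r_m-\frac12)$ if $\flat={<}$, where $r_M$ ($r_m$) is the max (min) of $\{p:(n-1,p)\in\widehat I_\xi\text{ or }(n,p)\in\widehat I_\xi\}$. $\overline I^{\mathrm{tw},\flat}_\xi$ is the image of $\widehat I^{\mathrm{tw},\flat}_\xi$ under the injective map $(\imath,s)\mapsto(\imath,2s)$ ($\imath\le n$), $(\imath,s)\mapsto(2n-\imath,2s)$ ($\imath>n$). For $(i,r)\in\overline I^{\mathrm{tw},\flat}_\xi$ put $k(i,r)=\#\{r'\in\mathbb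 Z:(i,r')\in\overline I^{\mathrm{tw},\flat}_\xi,\ r'-r\in2r_i\mathbb Z_{\ge0}\}$. $\mathcal Y_{t,\mathcal Q^\flat}$ is the $\mathbb Z[t^{\pm1/2}]$-subalgebra of $\mathcal Y_t$ generated by $\widetilde Y_{i,r}^{\pm1}$, $(i,r)\in\overline I^{\mathrm{tw},\flat}_\xi$. Quantum torus $\mathcal T_{\mathcal Q^\flat}$. List the first coordinates of the elements of $\widehat I^{\mathrm{tw},\flat}_\xi$ in order of decreasing second coordinate; elements with equal second coordinate have non-adjacent first coordinates and are listed in any order. This gives a reduced word $(\imath_1,\dots,\imath_\ell)$, $\ell=n(2n-1)$, of the longest element of the Weyl group of type $\mathrm A_{2n-1}$. The $k$-th position is identified with the corresponding element of $\overline I^{\mathrm{tw},\flat}_\xi$. Let $w_{\le k}=s_{\imath_1}\cdots s_{\imath_k}$, $\varpi_\imath$ the fundamental weights of $\mathrm A_{2n-1}$ and $(\cdot,\cdot)$ the invariant form with $(\alpha,\alpha)=2$. Let $\Lambda$ be the skew-symmetric integer matrix with \[ \lambda_{st}=(\varpi_{\imath_s}-w_{\le s}\varpi_{\imath_s},\varpi_{\imath_t}+w_{\le t}\varpi_{\imath_t})\quad(s<t). \] $\mathcal T_{\mathcal Q^\flat}$ is the free $\mathbb Z[v^{\pm1/2}]$-module with basis $\{X^{\bm a}\mid\bm a\in\mathbb Z^{\ell}\}$ and product $X^{\bm a}X^{\bm b}=v^{\Lambda(\bm a,\bm b)/2}X^{\bm a+\bm b}$. $X_{(i,r)}$ denotes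 $X^{\bm e_k}$ for the position $k$ corresponding to $(i,r)$. *)

theory Defs
  imports Complex_Main "HOL-Library.Poly_Mapping"
begin

text \<open>Cartan matrix c_ij = <h_i, alpha_j> of type B_n, indices 1..n, alpha_n short.\<close>
definition cartanB :: "nat \<Rightarrow> nat \<Rightarrow> nat \<Rightarrow> int" where
  "cartanB n i j =
     (if i = j then 2
      else if i = n \<and> j = n - 1 then -2
      else if \<bar>int i - int j\<bar> = 1 then -1 else 0)"

definition rB :: "nat \<Rightarrow> nat \<Rightarrow> int" where
  "rB n i = (if i < n then 2 else 1)"

text \<open>Coefficient of z^m in the Laurent polynomial (z^c - z^{-c})/(z - z^{-1}) (the quantum
  integer [c]_z), written out: for c \<noteq> 0 it equals sgn(c) * (z^{|c|-1} + z^{|c|-3} + ... + z^{1-|c|}).\<close>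
definition qint_coeff :: "int \<Rightarrow> int \<Rightarrow> int" where
  "qint_coeff c m =
     (if c \<noteq> 0 \<and> \<bar>m\<bar> \<le> \<bar>c\<bar> - 1 \<and> even (\<bar>c\<bar> - 1 - m) then sgn c else 0)"

text \<open>Coefficient of z^m in the entry C(z)_{ij}.\<close>
definition Cz :: "nat \<Rightarrow> nat \<Rightarrow> nat \<Rightarrow> int \<Rightarrow> int" where
  "Cz n i j m =
     (if i = j then (if m = rB n i then 1 else 0) + (if m = - rB n i then 1 else 0)
      else qint_coeff (cartanB n i j) m)"

text \<open>The coefficients ctilde_{ji}(r) of the expansion of C(z)^{-1}_{ji} in Z((z^{-1})):
  the unique family of integer sequences, supported on indices in {1..n}, each bounded above
  in its support (i.e. an element of Z((z^{-1}))), such that C(z) * Ctilde(z) = identity.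
  (All entries of C(z) have degrees in [-2,2].)\<close>
definition ctilde :: "nat \<Rightarrow> nat \<Rightarrow> nat \<Rightarrow> int \<Rightarrow> int" where
  "ctilde n = (THE F.
      (\<forall>j i r. (j \<notin> {1..n} \<or> i \<notin> {1..n}) \<longrightarrow> F j i r = 0) \<and>
      (\<forall>j i. \<exists>M. \<forall>r > M. F j i r = 0) \<and>
      (\<forall>j\<in>{1..n}. \<forall>i\<in>{1..n}. \<forall>r.
          (\<Sum>k\<in>{1..n}. \<Sum>m\<in>{-2..2}. Cz n j k m * F k i (r - m))
            = (if j = i \<and> r = 0 then 1 else 0)))"

definition gammaB :: "nat \<Rightarrow> nat \<times> int \<Rightarrow> nat \<times> int \<Rightarrow> int" where
  "gammaB n x y = (case x of (i, r) \<Rightarrow> case y of (j, s) \<Rightarrow>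
       ctilde n j i (- rB n j - r + s) + ctilde n j i (rB n j + r - s)
     - ctilde n j i (rB n j - r + s) - ctilde n j i (- rB n j + r - s))"

text \<open>An element of a quantum torus with exponent group 'g and a half-power variable q^{1/2}
  is a finitely supported function f :: 'g \<times> int \<Rightarrow> int, meaning
  sum over (a,k) of f(a,k) q^{k/2} X^a.  The product is X^a X^b = q^{N(a,b)/2} X^{a+b}.\<close>

type_synonym 'g qtor = "'g \<times> int \<Rightarrow> int"

definition qfin :: "'g qtor \<Rightarrow> bool" where
  "qfin f \<longleftrightarrow> finite {x. f x \<noteq> 0}"

definition qadd :: "'g qtor \<Rightarrow> 'g qtor \<Rightarrow> 'g qtor" where
  "qadd f g = (\<lambda>x. f x + g x)"

definition qneg :: "'g qtor \<Rightarrow> 'g qtor" where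
  "qneg f = (\<lambda>x. - f x)"

definition qmon :: "'g \<Rightarrow> int \<Rightarrow> 'g qtor" where
  "qmon a k = (\<lambda>x. if x = (a, k) then 1 else 0)"

definition qmult :: "('g::ab_group_add \<Rightarrow> 'g \<Rightarrow> int) \<Rightarrow> 'g qtor \<Rightarrow> 'g qtor \<Rightarrow> 'g qtor" where
  "qmult N f g = (\<lambda>(c, m).
     \<Sum>p\<in>{p. f p \<noteq> 0}. \<Sum>q\<in>{q. g q \<noteq> 0}.
       (if fst p + fst q = c \<and> snd p + snd q + N (fst p) (fst q) = m
        then f p * g q else 0))"

definition qbar :: "'g qtor \<Rightarrow> 'g qtor" where
  "qbar f = (\<lambda>(a, k). f (a, - k))"

text \<open>Y_t is realised as the quantum torus with exponent group the finitely supported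
  Z-valued functions on I \<times> Z, with X^a X^b = t^{N(a,b)/2} X^{a+b}, N the bilinear extension of
  gamma.  The generator tildeY_{i,r} is t^{1/2} X^{e_(i,r)}; then
  tildeY_x tildeY_y = t^{gamma(x,y)} tildeY_y tildeY_x, and qbar is the bar anti-involution
  (t^{1/2} \<mapsto> t^{-1/2}, tildeY_x \<mapsto> t^{-1} tildeY_x).\<close>

type_synonym yexp = "(nat \<times> int) \<Rightarrow>\<^sub>0 int"

definition NY :: "nat \<Rightarrow> yexp \<Rightarrow> yexp \<Rightarrow> int" where
  "NY n a b = (\<Sum>x\<in>Poly_Mapping.keys a. \<Sum>y\<in>Poly_Mapping.keys b. Poly_Mapping.lookup a x * Poly_Mapping.lookup b y * gammaB n x y)"

definition Yt_elems :: "yexp qtor set" where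
  "Yt_elems = {f. qfin f}"

definition Ygen :: "nat \<times> int \<Rightarrow> yexp qtor" where
  "Ygen x = qmon (Poly_Mapping.single x 1) 1"

text \<open>The inverse of Ygen x (note gamma(x,x) = 0).\<close>
definition Ygen_inv :: "nat \<times> int \<Rightarrow> yexp qtor" where
  "Ygen_inv x = qmon (Poly_Mapping.single x (-1)) (-1)"

definition Yprod :: "nat \<Rightarrow> (nat \<times> int) list \<Rightarrow> yexp qtor" where
  "Yprod n xs = foldr (\<lambda>x acc. qmult (NY n) (Ygen x) acc) xs (qmon 0 0)"

definition underline :: "nat \<Rightarrow> (nat \<times> int) list \<Rightarrow> yexp qtor" where
  "underline n xs = (THE u. qbar u = u \<and> (\<exists>a. u = qmult (NY n) (qmon 0 a) (Yprod n xs)))"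

inductive_set Ysubalg :: "nat \<Rightarrow> (nat \<times> int) set \<Rightarrow> yexp qtor set" for n S where
  scal: "qmon 0 k \<in> Ysubalg n S"
| gen: "x \<in> S \<Longrightarrow> Ygen x \<in> Ysubalg n S"
| geninv: "x \<in> S \<Longrightarrow> Ygen_inv x \<in> Ysubalg n S"
| add: "f \<in> Ysubalg n S \<Longrightarrow> g \<in> Ysubalg n S \<Longrightarrow> qadd f g \<in> Ysubalg n S"
| neg: "f \<in> Ysubalg n S \<Longrightarrow> qneg f \<in> Ysubalg n S"
| mult: "f \<in> Ysubalg n S \<Longrightarrow> g \<in> Ysubalg n S \<Longrightarrow> qmult (NY n) f g \<in> Ysubalg n S"

definition typeA_quiver :: "nat \<Rightarrow> (nat \<Rightarrow> nat \<Rightarrow> bool) \<Rightarrow> bool" where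
  "typeA_quiver m arr \<longleftrightarrow>
     (\<forall>i j. arr i j \<longrightarrow> i \<in> {1..m} \<and> j \<in> {1..m} \<and> (j = i + 1 \<or> i = j + 1)) \<and>
     (\<forall>i. 1 \<le> i \<longrightarrow> i < m \<longrightarrow> (arr i (i+1) \<longleftrightarrow> \<not> arr (i+1) i))"

definition height_fn :: "(nat \<Rightarrow> nat \<Rightarrow> bool) \<Rightarrow> (nat \<Rightarrow> int) \<Rightarrow> bool" where
  "height_fn arr \<xi> \<longleftrightarrow> (\<forall>i j. arr i j \<longrightarrow> \<xi> j = \<xi> i + 1)"

definition hatI :: "nat \<Rightarrow> (nat \<Rightarrow> int) \<Rightarrow> (nat \<times> int) set" where
  "hatI n \<xi> = {(i, p). 1 \<le> i \<and> i \<le> 2*n - 2 \<and> p mod 2 = \<xi> i mod 2 \<and>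
                       \<xi> (2*n - 1 - i) - (2 * int n - 1) < p \<and> p \<le> \<xi> i}"

definition rMax :: "nat \<Rightarrow> (nat \<Rightarrow> int) \<Rightarrow> int" where
  "rMax n \<xi> = Max {p. (n - 1, p) \<in> hatI n \<xi> \<or> (n, p) \<in> hatI n \<xi>}"

definition rMin :: "nat \<Rightarrow> (nat \<Rightarrow> int) \<Rightarrow> int" where
  "rMin n \<xi> = Min {p. (n - 1, p) \<in> hatI n \<xi> \<or> (n, p) \<in> hatI n \<xi>}"

text \<open>The twisted set hatI^{tw,flat}_xi, with the half-integer second coordinate s recorded as the
  integer 2s.  The flag gt is True for flat = '>' and False for flat = '<'.\<close>
definition hatItw :: "nat \<Rightarrow> (nat \<Rightarrow> int) \<Rightarrow> bool \<Rightarrow> (nat \<times> int) set" where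
  "hatItw n \<xi> gt =
     {(i, 2 * p) | i p. (i, p) \<in> hatI n \<xi> \<and> i \<le> n - 1}
   \<union> {(i + 1, 2 * p) | i p. (i, p) \<in> hatI n \<xi> \<and> i \<ge> n}
   \<union> {(n, 2 * p - 1) | p. ({(n - 1, p - 1), (n, p)} \<subseteq> hatI n \<xi>)
                          \<or> ({(n, p - 1), (n - 1, p)} \<subseteq> hatI n \<xi>)}
   \<union> {if gt then (n, 2 * rMax n \<xi> + 1) else (n, 2 * rMin n \<xi> - 1)}"

text \<open>The map (iota, s) \<mapsto> (iota, 2s) / (2n - iota, 2s); here the input already carries 2s.\<close>
definition ovl :: "nat \<Rightarrow> nat \<times> int \<Rightarrow> nat \<times> int" where
  "ovl n x = (case x of (\<iota>, s2) \<Rightarrow> if \<iota> \<le> n then (\<iota>, s2) else (2 * n - \<iota>, s2))"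

definition barItw :: "nat \<Rightarrow> (nat \<Rightarrow> int) \<Rightarrow> bool \<Rightarrow> (nat \<times> int) set" where
  "barItw n \<xi> gt = ovl n ` hatItw n \<xi> gt"

definition kk :: "nat \<Rightarrow> (nat \<Rightarrow> int) \<Rightarrow> bool \<Rightarrow> nat \<times> int \<Rightarrow> nat" where
  "kk n \<xi> gt x = (case x of (i, r) \<Rightarrow>
     card {r'. (i, r') \<in> barItw n \<xi> gt \<and> (\<exists>m::nat. r' - r = 2 * rB n i * int m)})"

definition mlist :: "nat \<Rightarrow> nat \<Rightarrow> int \<Rightarrow> nat \<Rightarrow> (nat \<times> int) list" where
  "mlist n i r k = map (\<lambda>s. (i, r + 2 * rB n i * (int s - 1))) [1..<k+1]"

definition ellB :: "nat \<Rightarrow> nat" where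
  "ellB n = n * (2 * n - 1)"

text \<open>Weights of A_{2n-1} realised in the standard way in Q^{2n} (coordinates 1..2n):
  varpi_i = eps_1 + ... + eps_i - (i/2n)(eps_1 + ... + eps_2n); the simple reflection s_i swaps the
  coordinates i and i+1; the invariant form is the standard dot product (so (alpha,alpha) = 2).\<close>
definition fw :: "nat \<Rightarrow> nat \<Rightarrow> nat \<Rightarrow> rat" where
  "fw n i = (\<lambda>j. (if j \<le> i then 1 else 0) - of_nat i / of_nat (2 * n))"

definition sref :: "nat \<Rightarrow> (nat \<Rightarrow> rat) \<Rightarrow> nat \<Rightarrow> rat" where
  "sref i v = (\<lambda>j. if j = i then v (i + 1) else if j = i + 1 then v i else v j)"

definition ipA :: "nat \<Rightarrow> (nat \<Rightarrow> rat) \<Rightarrow> (nat \<Rightarrow> rat) \<Rightarrow> rat" where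
  "ipA n u v = (\<Sum>j\<in>{1..2*n}. u j * v j)"

definition wle :: "(nat \<Rightarrow> nat) \<Rightarrow> nat \<Rightarrow> (nat \<Rightarrow> rat) \<Rightarrow> nat \<Rightarrow> rat" where
  "wle w k v = foldr sref (map w [1..<k+1]) v"

text \<open>lambda_{st} for s < t (an integer by the paper; computed in Q and read as an integer).\<close>
definition lam :: "nat \<Rightarrow> (nat \<Rightarrow> nat) \<Rightarrow> nat \<Rightarrow> nat \<Rightarrow> int" where
  "lam n w s t = \<lfloor>ipA n (\<lambda>j. fw n (w s) j - wle w s (fw n (w s)) j)
                         (\<lambda>j. fw n (w t) j + wle w t (fw n (w t)) j)\<rfloor>"

definition LamM :: "nat \<Rightarrow> (nat \<Rightarrow> nat) \<Rightarrow> nat \<Rightarrow> nat \<Rightarrow> int" where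
  "LamM n w s t = (if s < t then lam n w s t else if t < s then - lam n w t s else 0)"

type_synonym texp = "nat \<Rightarrow>\<^sub>0 int"

definition NT :: "nat \<Rightarrow> (nat \<Rightarrow> nat) \<Rightarrow> texp \<Rightarrow> texp \<Rightarrow> int" where
  "NT n w a b = (\<Sum>s\<in>{1..ellB n}. \<Sum>t\<in>{1..ellB n}. Poly_Mapping.lookup a s * Poly_Mapping.lookup b t * LamM n w s t)"

definition T_elems :: "nat \<Rightarrow> texp qtor set" where
  "T_elems n = {f. qfin f \<and> (\<forall>a k. f (a, k) \<noteq> 0 \<longrightarrow> Poly_Mapping.keys a \<subseteq> {1..ellB n})}"

end

theory Submission
  imports Defs
begin

text \<open>
  Write \<open>\<beta>\<^sub>k = w\<^bsub><k\<^esub> \<alpha>\<close> for the \<open>k\<close>-th root of the reduced word. Everything reduces to the identity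
  \<open>\<gamma>(x\<^sub>k; x\<^sub>l) = (\<beta>\<^sub>k, \<beta>\<^sub>l)\<close> for positions \<open>k < l\<close>, where \<open>x\<^sub>k\<close> is the vertex at position \<open>k\<close>.
  Indeed \<open>\<varpi> - w\<^bsub>\<le>s\<^esub> \<varpi>\<close> is the sum of the roots in one column up to \<open>s\<close>, so that \<open>\<lambda>\<^bsub>st\<^esub>\<close> becomes a
  signed double sum of root pairings, which is minus the bilinear extension of \<open>\<gamma>\<close> evaluated on the
  two monomials. The identity holds because both sides obey one recursion along the word: applying
  a letter changes \<open>(\<beta>\<^sub>k, w\<^bsub>\<le>t\<^esub> \<varpi>)\<close> by \<open>s\<^sub>i \<varpi>\<^sub>i + \<varpi>\<^sub>i = \<varpi>\<^bsub>i-1\<^esub> + \<varpi>\<^bsub>i+1\<^esub>\<close>, and after folding type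
  \<open>A\<^bsub>2n-1\<^esub>\<close> onto type \<open>B\<^sub>n\<close> this is the relation \<open>C(z) C(z)\<^sup>-\<^sup>1 = 1\<close> read off at one power of \<open>z\<close>.
  The exponent map is unitriangular on each column, hence a lattice isomorphism, and the
  isomorphism of quantum tori follows.
\<close>

text \<open>The recursion runs over t with k fixed and follows the whole vector of pairings (beta_k,
  w_(<=t) varpi_j), j = 0, ..., 2n: a step at one letter involves the neighbouring letters, so root
  pairings alone would not close up. The degree in which \<open>ctilde\<close> is read in column j
  is set by the lowest vertex already placed there, its \<open>front\<close>. One obstacle is thus
  to locate the neighbouring fronts when a vertex is placed. The word decreases only weakly in
  height and the ends of the columns depend on xi, so ties and ends both need an argument. The other
  obstacle is the start t = k, where every column but that of k must contribute 0. The general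
  degree bound -r_j is too weak for this. The exact order of vanishing of the entries is needed, and
  for columns on opposite sides of the middle also a parity argument: a walk of the wrong parity
  must use the loop of the folded path. Of the four terms of gamma only two survive for k < l,
  because the expansion in z^-1 has no terms of degree above -r_j. The minus sign between lambda and
  gamma is the reason why v goes to the inverse of t.\<close>

section \<open>The inverse quantum Cartan matrix\<close>

text \<open>Eliminating the last row of \<open>C(z)\<close> leaves \<open>z\<^sup>2 + z\<^sup>-\<^sup>2 - A\<close>, where \<open>A\<close> is the adjacency matrix of the
  path on \<open>1, \<dots>, n - 1\<close> with a loop at \<open>n - 1\<close>; \<open>cheb n t\<close> is the coefficient of \<open>z\<^sup>-\<^sup>2\<^sup>t\<close> in its inverse.\<close>
fun cheb :: "nat \<Rightarrow> nat \<Rightarrow> nat \<Rightarrow> nat \<Rightarrow> int" where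
  "cheb n 0 j i = 0"
| "cheb n (Suc 0) j i = (if 1 \<le> j \<and> j < n \<and> j = i then 1 else 0)"
| "cheb n (Suc (Suc t)) j i =
     (if 1 \<le> j \<and> j < n
      then cheb n (Suc t) (j - 1) i + cheb n (Suc t) (min (j + 1) (n - 1)) i - cheb n t j i
      else 0)"

lemma cheb_row_outside: "j = 0 \<or> j \<ge> n \<Longrightarrow> cheb n t j i = 0"
  by (induction n t j i rule: cheb.induct) auto

lemma cheb_col_zero: "cheb n t j 0 = 0"
  by (induction n t j "0::nat" rule: cheb.induct) auto

text \<open>\<open>cheb n t\<close> is a polynomial in the adjacency matrix A, namely the Chebyshev
  polynomial U_(t-1) at A/2. It commutes with A, so the recursion that multiplies by A on the left
  also holds on the right.\<close>

lemma cheb_column_rec: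
  assumes "1 \<le> i" "i < n"
  shows "cheb n (Suc (Suc t)) j i =
    cheb n (Suc t) j (i - 1) + cheb n (Suc t) j (min (i + 1) (n - 1)) - cheb n t j i"
proof (induction t arbitrary: j rule: less_induct)
  case (less t)
  show ?case
  proof (cases "1 \<le> j \<and> j < n")
    case False
    then show ?thesis using cheb_row_outside[of j n] by (auto simp: not_le not_less)
  next
    case True
    consider "t = 0" | "t = 1" | u where "t = Suc (Suc u)"
      by (metis One_nat_def not0_implies_Suc)
    then show ?thesis
    proof cases
      case 1
      obtain j' i' where "j = Suc j'" "i = Suc i'" using True assms by (metis Suc_le_D One_nat_def)
      then show ?thesis using True assms 1 by (simp add: min_def) linarith
    next
      case 2
      have IH: "cheb n 2 j' i = cheb n 1 j' (i - 1) + cheb n 1 j' (min (i + 1) (n - 1))" for j'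
        using less[of 0 j'] 2 by (simp add: numeral_2_eq_2)
      have "cheb n 3 j i = cheb n 2 (j-1) i + cheb n 2 (min (j+1) (n-1)) i - cheb n 1 j i"
        using True by (simp add: numeral_3_eq_3 numeral_2_eq_2)
      also have "\<dots> = cheb n 2 j (i-1) + cheb n 2 j (min (i+1) (n-1)) - cheb n 1 j i"
        unfolding IH using True by (simp add: numeral_2_eq_2)
      finally show ?thesis using 2 by (simp add: numeral_3_eq_3 numeral_2_eq_2)
    next
      case (3 u)
      have IH1: "cheb n (Suc (Suc (Suc u))) j' i = cheb n (Suc (Suc u)) j' (i - 1)
            + cheb n (Suc (Suc u)) j' (min (i + 1) (n - 1)) - cheb n (Suc u) j' i" for j'
        using less[of "Suc u" j'] 3 by simp
      have IH2: "cheb n (Suc (Suc u)) j i = cheb n (Suc u) j (i - 1)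
            + cheb n (Suc u) j (min (i + 1) (n - 1)) - cheb n u j i"
        using less[of "u" j] 3 by simp
      have row: "cheb n (Suc (Suc s)) j k = cheb n (Suc s) (j-1) k
            + cheb n (Suc s) (min (j+1) (n-1)) k - cheb n s j k" for s k
        using True by simp
      have "cheb n (Suc (Suc t)) j i = cheb n (Suc t) (j-1) i
            + cheb n (Suc t) (min (j+1) (n-1)) i - cheb n t j i"
        by (rule row)
      also have "\<dots> = cheb n (Suc t) j (i - 1) + cheb n (Suc t) j (min (i + 1) (n - 1)) - cheb n t j i"
        unfolding 3 IH1 row[of "Suc u" "i-1"] row[of "Suc u" "min (i+1) (n-1)"]
        using IH2 row[of u i] by linarith
      finally show ?thesis .
    qed
  qed
qed

text \<open>A polynomial in the symmetric matrix A is symmetric: the row recursion at (j, i) is the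
  column recursion at (i, j).\<close>

lemma cheb_sym:
  assumes "1 \<le> j" "j < n" "1 \<le> i" "i < n"
  shows "cheb n t j i = cheb n t i j"
  using assms
proof (induction t arbitrary: i j rule: less_induct)
  case (less t)
  consider "t = 0" | "t = 1" | u where "t = Suc (Suc u)"
    by (metis One_nat_def not0_implies_Suc)
  then show ?case
  proof cases
    case (3 u)
    have m: "1 \<le> min (j+1) (n-1)" "min (j+1) (n-1) < n" using less.prems by auto
    have z: "cheb n (Suc u) (j-1) i = cheb n (Suc u) i (j-1)"
      using less.IH[of "Suc u" "j-1" i] less.prems 3
      by (cases "j = 1") (auto simp: cheb_row_outside cheb_col_zero)
    have "cheb n t j i = cheb n (Suc u) (j-1) i + cheb n (Suc u) (min (j+1) (n-1)) i - cheb n u j i"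
      using 3 less.prems by simp
    also have "\<dots> = cheb n (Suc u) i (j-1) + cheb n (Suc u) i (min (j+1) (n-1)) - cheb n u i j"
      using less.IH[of "Suc u" "min (j+1) (n-1)" i] less.IH[of u j i] less.prems 3 m z by simp
    also have "\<dots> = cheb n t i j"
      unfolding 3 using cheb_column_rec[of j n u i] less.prems by simp
    finally show ?thesis .
  qed (use less.prems in auto)
qed

text \<open>The second alternative is the distance measured through the loop at \<open>n - 1\<close>; a path
  of the wrong parity must traverse the loop.\<close>
lemma cheb_vanish:
  assumes "1 \<le> j" "j < n" "1 \<le> i" "i < n"
  shows "int t \<le> \<bar>int i - int j\<bar> \<or> (even (int t - int i + int j) \<and> t + i + j + 1 \<le> 2 * n)
    \<Longrightarrow> cheb n t j i = 0"
  using assms(1,2)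
proof (induction t arbitrary: j rule: less_induct)
  case (less t)
  consider "t = 0" | "t = 1" | u where "t = Suc (Suc u)"
    by (metis One_nat_def not0_implies_Suc)
  then show ?case
  proof cases
    case 2
    then show ?thesis using less.prems by auto
  next
    case (3 u)
    have "cheb n u j i = 0"
      by (rule less.IH) (use 3 less.prems in auto)
    moreover have "cheb n (Suc u) (j - 1) i = 0"
    proof (cases "j = 1")
      case False
      then show ?thesis by (intro less.IH) (use 3 less.prems in \<open>auto simp: of_nat_diff\<close>)
    qed (simp add: cheb_row_outside)
    moreover have "cheb n (Suc u) (min (j + 1) (n - 1)) i = 0"
    proof (cases "j + 1 < n")
      case True
      then have "min (j+1) (n-1) = j+1" by simp
      then show ?thesis using True by (simp, intro less.IH) (use 3 less.prems in auto)
    next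
      case False
      then have j: "min (j+1) (n-1) = j" "n = j + 1" using less.prems by auto
      show ?thesis unfolding j(1) by (rule less.IH) (use 3 less.prems j assms in auto)
    qed
    ultimately show ?thesis using 3 by simp
  qed simp
qed

text \<open>The coefficient of z^(-2t-1) in the series of \<open>cheb n s j (n - 1)\<close> z^(-2s),
  divided by z + z^-1. The alternating signs are those of 1/(z + z^-1), the sum of (-1)^u
  z^(-2u-1).\<close>

fun cheb_alt :: "nat \<Rightarrow> nat \<Rightarrow> nat \<Rightarrow> int" where
  "cheb_alt n 0 j = 0"
| "cheb_alt n (Suc t) j = cheb n (Suc t) j (n - 1) - cheb_alt n t j"

lemma cheb_alt_vanish:
  assumes "1 \<le> j" "j < n" "t + j < n"
  shows "cheb_alt n t j = 0"
  using assms by (induction t) (auto intro: cheb_vanish)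

lemma cheb_alt_row_zero: "cheb_alt n t 0 = 0"
  by (induction t) (auto simp: cheb_row_outside)

text \<open>The source of the Chebyshev recursion is the diagonal 1 at t = 1. Division by z + z^-1
  spreads it over all t with alternating signs, in row n - 1 only.\<close>

lemma cheb_alt_rec:
  assumes "1 \<le> j" "j < n"
  shows "cheb_alt n (Suc (Suc t)) j + cheb_alt n t j =
    cheb_alt n (Suc t) (j - 1) + cheb_alt n (Suc t) (min (j + 1) (n - 1))
     - (if j = n - 1 then (-1) ^ t else 0)"
proof (induction t)
  case 0
  then show ?case using assms by auto
next
  case (Suc t)
  have "cheb_alt n (Suc (Suc (Suc t))) j + cheb_alt n (Suc t) j
      = cheb n (Suc (Suc (Suc t))) j (n - 1) + cheb n (Suc t) j (n - 1)
        - (cheb_alt n (Suc (Suc t)) j + cheb_alt n t j)"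
    by simp
  also have "cheb n (Suc (Suc (Suc t))) j (n - 1) + cheb n (Suc t) j (n - 1)
     = cheb n (Suc (Suc t)) (j-1) (n - 1) + cheb n (Suc (Suc t)) (min (j+1) (n-1)) (n - 1)"
    using assms by simp
  finally show ?case unfolding Suc by simp
qed

text \<open>The last equation of C(z) F = 1 reads (z + z^-1)(F_n - F_(n-1)) = delta. For i < n row n
  therefore repeats row n - 1, whence \<open>min j (n - 1)\<close>; for i = n it exceeds row n - 1
  by 1/(z + z^-1), which is the term with (-1)^t.\<close>

definition ctilde_sol :: "nat \<Rightarrow> nat \<Rightarrow> nat \<Rightarrow> int \<Rightarrow> int" where
  "ctilde_sol n j i m =
    (if j \<notin> {1..n} \<or> i \<notin> {1..n} \<or> m > 0 then 0
     else if i < n then (if even m then cheb n (nat (- m div 2)) (min j (n - 1)) i else 0)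
     else (if odd m then cheb_alt n (nat ((- m - 1) div 2)) (min j (n - 1))
             + (if j = n then (-1) ^ nat ((- m - 1) div 2) else 0) else 0))"

section \<open>Existence and uniqueness of the inverse of C(z)\<close>

lemma row_sum:
  fixes F :: "nat \<Rightarrow> int \<Rightarrow> int"
  assumes "n \<ge> 2" "1 \<le> j" "j \<le> n" "F 0 = (\<lambda>_. 0)"
  shows "(\<Sum>k\<in>{1..n}. \<Sum>m\<in>{-2..2}. Cz n j k m * F k (r - m)) =
    (if j < n then F j (r - 2) + F j (r + 2) - F (j - 1) r - F (j + 1) r
     else F n (r - 1) + F n (r + 1) - F (n - 1) (r - 1) - F (n - 1) (r + 1))"
proof -
  have S: "{-2..2} = {-2, -1, 0, 1, 2::int}" by auto
  define h where "h k = (\<Sum>m\<in>{-2..2}. Cz n j k m * F k (r - m))" for k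
  \<comment> \<open>Off the diagonal all nonzero entries are -1, except C_(n,n-1) = -(z + z^-1),
    which produces the two shifted terms.\<close>
  have h: "h k = (if k = j then F j (r - rB n j) + F j (r + rB n j)
      else if j = n \<and> k = n - 1 then - F k (r-1) - F k (r+1)
      else if \<bar>int j - int k\<bar> = 1 then - F k r else 0)" for k
    unfolding h_def S by (auto simp: Cz_def qint_coeff_def cartanB_def rB_def)
  show ?thesis
  proof (cases "j < n")
    case True
    have "(\<Sum>k\<in>{1..n}. h k) = (\<Sum>k\<in>{1..n} \<inter> {j - 1, j, j + 1}. h k)"
      by (rule sum.mono_neutral_right) (auto simp: h)
    also have "\<dots> = (\<Sum>k\<in>{j - 1, j, j + 1}. h k)"
      by (rule sum.mono_neutral_left) (use True assms in \<open>auto simp: h\<close>)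
    also have "\<dots> = F j (r - 2) + F j (r + 2) - F (j - 1) r - F (j + 1) r"
    proof -
      have "j - 1 \<noteq> j" "j - 1 \<noteq> j + 1" "j \<noteq> j + 1" using True assms by auto
      then have "(\<Sum>k\<in>{j - 1, j, j + 1}. h k) = h (j - 1) + h j + h (j + 1)" by simp
      moreover have "h (j - 1) = - F (j - 1) r" "h j = F j (r - 2) + F j (r + 2)" "h (j + 1) = - F (j + 1) r"
        unfolding h using True assms by (auto simp: rB_def)
      ultimately show ?thesis by simp
    qed
    finally show ?thesis using True by (simp add: h_def)
  next
    case False
    then have j: "j = n" using assms by simp
    have "(\<Sum>k\<in>{1..n}. h k) = (\<Sum>k\<in>{n - 1, n}. h k)"
      by (rule sum.mono_neutral_right) (use assms in \<open>auto simp: h j\<close>)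
    also have "\<dots> = F n (r - 1) + F n (r + 1) - F (n - 1) (r - 1) - F (n - 1) (r + 1)"
    proof -
      have "n - 1 \<noteq> n" using assms by auto
      then have "(\<Sum>k\<in>{n - 1, n}. h k) = h (n - 1) + h n" by simp
      moreover have "h n = F n (r - 1) + F n (r + 1)" "h (n - 1) = - F (n - 1) (r - 1) - F (n - 1) (r + 1)"
        unfolding h using assms by (auto simp: rB_def j)
      ultimately show ?thesis by simp
    qed
    finally show ?thesis using j by (simp add: h_def)
  qed
qed

lemma int_even_cases:
  fixes m :: int
  assumes "even m"
  obtains "m > 2" | "m = 2" | "m = 0" | t :: nat where "m = - 2 * int (Suc t)"
proof -
  have "m \<noteq> 1" using assms by auto
  then consider "m > 2" | "m = 2" | "m = 0" | "m < 0" by linarith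
  then show thesis
  proof cases
    case 4
    then have "m = -2 * int (Suc (nat (- m div 2 - 1)))" using assms by auto
    then show thesis using that by blast
  qed (use that in auto)
qed

lemma ctilde_sol_even: "j \<in> {1..n} \<Longrightarrow> i \<in> {1..<n} \<Longrightarrow>
   ctilde_sol n j i (- 2 * int t) = cheb n t (min j (n - 1)) i"
  by (simp add: ctilde_sol_def)

lemma ctilde_sol_odd: "j \<in> {1..n} \<Longrightarrow> 
   ctilde_sol n j n (- 2 * int t - 1) = cheb_alt n t (min j (n - 1)) + (if j = n then (-1) ^ t else 0)"
  by (simp add: ctilde_sol_def)

lemma ctilde_sol_pos: "m > 0 \<Longrightarrow> ctilde_sol n j i m = 0"
  by (simp add: ctilde_sol_def)

lemma ctilde_sol_zero: "ctilde_sol n j i 0 = 0"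
  by (simp add: ctilde_sol_def)

lemma ctilde_sol_outside: "j \<notin> {1..n} \<Longrightarrow> ctilde_sol n j i m = 0"
  by (simp add: ctilde_sol_def)

lemma ctilde_sol_parity: "i \<in> {1..n} \<Longrightarrow> (odd m \<longleftrightarrow> i < n) \<Longrightarrow> ctilde_sol n j i m = 0"
  by (auto simp add: ctilde_sol_def)

lemma int_odd_cases:
  fixes m :: int
  assumes "odd m"
  obtains "m > 2" | "m = 1" | "m = -1" | t :: nat where "m = - 2 * int (Suc t) - 1"
proof -
  have "m \<noteq> 0" "m \<noteq> 2" using assms by auto
  then consider "m > 2" | "m = 1" | "m = -1" | "m < -1" by linarith
  then show thesis
  proof cases
    case 4
    then have "m = -2 * int (Suc (nat ((- m - 1) div 2 - 1))) - 1" using assms by (auto elim!: oddE)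
    then show thesis using that by blast
  qed (use that in auto)
qed

text \<open>In degrees of the wrong parity for column i all terms vanish; in the others this is the
  Chebyshev recursion. For j = n - 1 the neighbour n acts as the loop, and if also i = n, the
  surplus (-1)^t of row n cancels the source term of \<open>cheb_alt_rec\<close>.\<close>

lemma ctilde_sol_row:
  assumes "n \<ge> 2" "1 \<le> j" "j < n" "i \<in> {1..n}"
  shows "ctilde_sol n j i (m - 2) + ctilde_sol n j i (m + 2)
     - ctilde_sol n (j - 1) i m - ctilde_sol n (j + 1) i m = (if j = i \<and> m = 0 then 1 else 0)"
proof (cases "odd m \<longleftrightarrow> i < n")
  case True
  moreover from True have "odd (m-2) \<longleftrightarrow> i < n" "odd (m+2) \<longleftrightarrow> i < n" by auto
  ultimately show ?thesis using assms by (auto simp: ctilde_sol_parity)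
next
  case False
  have j: "min j (n - 1) = j" "min (j - 1) (n - 1) = j - 1" "min n (n-1) = n-1" using assms by auto
  show ?thesis
  proof (cases "i < n")
    case True
    with False have "even m" by auto
    have i: "i \<in> {1..<n}" using True assms by auto
    have out: "ctilde_sol n (j - 1) i (- 2 * int t) = cheb n t (j - 1) i" for t
      using ctilde_sol_even[of "j-1" n i t] i assms j
      by (cases "j = 1") (simp_all add: cheb_row_outside ctilde_sol_outside, linarith)
    note ev = ctilde_sol_even[OF _ i]
    from \<open>even m\<close> show ?thesis
    proof (cases rule: int_even_cases)
      case 1
      then show ?thesis by (simp add: ctilde_sol_pos)
    next
      case 2
      then show ?thesis by (simp add: ctilde_sol_pos ctilde_sol_zero)
    next
      case 3
      then show ?thesis using ev[of j 1] assms j by (auto simp: ctilde_sol_pos ctilde_sol_zero)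
    next
      case (4 t)
      have "m - 2 = - 2 * int (Suc (Suc t))" "m + 2 = - 2 * int t" using 4 by auto
      moreover have "Suc 0 \<le> n - Suc 0" using assms by auto
      ultimately show ?thesis
        using ev[of j "Suc (Suc t)"] ev[of j t] ev[of "j+1" "Suc t"] out[of "Suc t"] 4 assms j by simp
    qed
  next
    case False
    with \<open>\<not> (odd m \<longleftrightarrow> i < n)\<close> assms have "odd m" "i = n" by auto
    have jn: "j - 1 \<noteq> n" "j \<noteq> 1 \<Longrightarrow> j - 1 \<in> {1..n}" using assms by auto
    have out: "ctilde_sol n (j - 1) n (- 2 * int t - 1) = cheb_alt n t (j - 1)" for t
      using jn ctilde_sol_odd[of "j-1" n t] assms j
      by (cases "j = 1") (auto simp: cheb_alt_row_zero ctilde_sol_outside)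
    note od = ctilde_sol_odd[of _ n]
    from \<open>odd m\<close> show ?thesis
    proof (cases rule: int_odd_cases)
      case 1
      then show ?thesis by (simp add: ctilde_sol_pos)
    next
      case 2
      then show ?thesis using od[of j 0] j assms \<open>i = n\<close> by (simp add: ctilde_sol_pos)
    next
      case 3
      then show ?thesis using od[of j 1] od[of "j+1" 0] out[of 0] assms j \<open>i = n\<close>
        by (auto simp: ctilde_sol_pos)
    next
      case (4 t)
      have m: "m - 2 = - 2 * int (Suc (Suc t)) - 1" "m + 2 = - 2 * int t - 1" using 4 by auto
      have r: "j \<in> {1..n}" "j + 1 \<in> {1..n}" "j \<noteq> n" "j + 1 = n \<longleftrightarrow> j = n - 1" using assms by auto
      have "ctilde_sol n j n (m - 2) = cheb_alt n (Suc (Suc t)) j"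
        unfolding m(1) od[OF r(1)] j using r(3) by simp
      moreover have "ctilde_sol n j n (m + 2) = cheb_alt n t j"
        unfolding m(2) od[OF r(1)] j using r(3) by simp
      moreover have "ctilde_sol n (j - 1) n m = cheb_alt n (Suc t) (j - 1)"
        unfolding 4 by (rule out)
      moreover have "ctilde_sol n (j + 1) n m = cheb_alt n (Suc t) (min (j + 1) (n - 1))
           - (if j = n - 1 then (-1) ^ t else 0)"
        unfolding 4 od[OF r(2)] r(4) by (simp del: cheb_alt.simps)
      moreover have "m \<noteq> 0" using 4 by simp
      ultimately show ?thesis using cheb_alt_rec[of j n t] assms(2,3)
        unfolding \<open>i = n\<close> by (simp del: cheb_alt.simps)
    qed
  qed
qed

lemma ctilde_sol_last_row:
  assumes "n \<ge> 2" "i \<in> {1..n}"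
  shows "ctilde_sol n n i (m - 1) + ctilde_sol n n i (m + 1)
     - ctilde_sol n (n - 1) i (m - 1) - ctilde_sol n (n - 1) i (m + 1) = (if n = i \<and> m = 0 then 1 else 0)"
proof (cases "i < n")
  case True
  then have "ctilde_sol n n i m = ctilde_sol n (n - 1) i m" for m
    using assms by (auto simp: ctilde_sol_def)
  then show ?thesis using True by simp
next
  case False
  then have i: "i = n" using assms by simp
  \<comment> \<open>D is the expansion of 1/(z + z^-1), and the claim says that z + z^-1 times it is
    1.\<close>
  define D where "D m = ctilde_sol n n n m - ctilde_sol n (n - 1) n m" for m
  have D: "D m = (if odd m \<and> m < 0 then (-1) ^ nat ((- m - 1) div 2) else 0)" for m
    using assms by (auto simp: D_def ctilde_sol_def dest: odd_pos)
  have "D (m - 1) + D (m + 1) = (if m = 0 then 1 else 0)"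
  proof (cases "even m \<and> m < 0")
    case True
    then have e: "nat ((- (m - 1) - 1) div 2) = Suc (nat ((- (m + 1) - 1) div 2))"
      by (auto elim!: evenE)
    show ?thesis unfolding D e using True by (auto)
  next
    case False
    then show ?thesis unfolding D by (cases "m = 0"; cases "even m") auto
  qed
  then show ?thesis using i by (simp add: D_def)
qed

text \<open>For uniqueness, the difference E of two solutions solves the homogeneous system and is
  bounded above in degree. Row j < n expresses its value in degree r - 2 through values in higher
  degrees, so E vanishes by descent from a common bound M.\<close>

lemma ctilde_eq: 
  assumes n: "n \<ge> 2"
  shows "ctilde n = ctilde_sol n"
  unfolding ctilde_def
proof (rule the_equality, goal_cases)
  case 1
  show ?case
  proof (intro conjI)
    show "\<forall>j i r. (j \<notin> {1..n} \<or> i \<notin> {1..n}) \<longrightarrow> ctilde_sol n j i r = 0"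
      by (auto simp: ctilde_sol_def)
    show "\<forall>j i. \<exists>M. \<forall>r > M. ctilde_sol n j i r = 0"
      by (auto intro!: exI[of _ 0] simp: ctilde_sol_pos)
    show "\<forall>j\<in>{1..n}. \<forall>i\<in>{1..n}. \<forall>r.
          (\<Sum>k\<in>{1..n}. \<Sum>m\<in>{-2..2}. Cz n j k m * ctilde_sol n k i (r - m))
            = (if j = i \<and> r = 0 then 1 else 0)"
    proof (intro ballI allI)
      fix j i r assume ij: "j \<in> {1..n}" "i \<in> {1..n}"
      have z: "ctilde_sol n 0 i = (\<lambda>_. 0)" by (auto simp: ctilde_sol_def)
      show "(\<Sum>k\<in>{1..n}. \<Sum>m\<in>{-2..2}. Cz n j k m * ctilde_sol n k i (r - m))
            = (if j = i \<and> r = 0 then 1 else 0)"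
        using row_sum[of n j "\<lambda>k. ctilde_sol n k i" r] ij n z
          ctilde_sol_row[of n j i r] ctilde_sol_last_row[of n i r] by (auto split: if_splits)
    qed
  qed
next
  case (2 F)
  then have out: "j \<notin> {1..n} \<or> i \<notin> {1..n} \<Longrightarrow> F j i r = 0"
    and bdd: "\<exists>M. \<forall>r > M. F j i r = 0"
    and eq: "j \<in> {1..n} \<Longrightarrow> i \<in> {1..n} \<Longrightarrow>
          (\<Sum>k\<in>{1..n}. \<Sum>m\<in>{-2..2}. Cz n j k m * F k i (r - m)) = (if j = i \<and> r = 0 then 1 else 0)" 
    for j i r by blast+
  have "F j i r = ctilde_sol n j i r" for j i r
  proof (cases "i \<in> {1..n}")
    case i: True
    define E where "E j r = F j i r - ctilde_sol n j i r" for j r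
    have E0: "E 0 = (\<lambda>_. 0)" using out by (auto simp: E_def ctilde_sol_def)
    have F0: "F 0 i = (\<lambda>_. 0)" using out by auto
    have row: "E j (r - 2) + E j (r + 2) - E (j - 1) r - E (j + 1) r = 0" if "1 \<le> j" "j < n" for j r
      using row_sum[of n j "\<lambda>k. F k i" r] eq[of j i r] ctilde_sol_row[of n j i r] that n i F0
      by (auto simp: E_def)
    have lrow: "E n (r - 1) + E n (r + 1) - E (n - 1) (r - 1) - E (n - 1) (r + 1) = 0" for r
      using row_sum[of n n "\<lambda>k. F k i" r] eq[of n i r] ctilde_sol_last_row[of n i r] n i F0
      by (auto simp: E_def)
    from bdd have "\<forall>j. \<exists>M. \<forall>r > M. F j i r = 0" by blast
    then obtain B where B: "\<forall>j. \<forall>r > B j. F j i r = 0" by metis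
    define M where "M = Max (insert 0 (B ` {0..n}))"
    have M: "E j r = 0" if "r > M" "j \<in> {0..n}" for j r
    proof -
      have "B j \<le> M" "0 \<le> M" unfolding M_def using that by (auto intro!: Max_ge simp del: Max_insert)
      then show ?thesis using B that by (simp add: E_def ctilde_sol_pos)
    qed
    have main: "\<forall>j\<in>{0..n}. E j (M - int t) = 0" for t
    proof (induction t rule: less_induct)
      case (less t)
      have hi: "E j r = 0" if "r > M - int t" "j \<in> {0..n}" for j r
      proof (cases "r > M")
        case True
        then show ?thesis using M that by blast
      next
        case False
        then have "r = M - int (nat (M - r))" "nat (M - r) < t" using that by auto
        then show ?thesis using less that by metis
      qed
      have lt: "E j (M - int t) = 0" if "j < n" for j
      proof (cases "j = 0")
        case False
        then show ?thesis
          using row[of j "M - int t + 2"] hi[of "M - int t + 2" "j-1"] hi[of "M - int t + 2" "j+1"]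
            hi[of "M - int t + 4" "j"] that by (simp add: add.commute)
      qed (simp add: E0)
      \<comment> \<open>The last equation also contains E (n - 1) in this same degree, so the rows j
        < n must be settled before row n.\<close>
      have "E n (M - int t) = 0"
        using lrow[of "M - int t + 1"] hi[of "M - int t + 2" "n-1"] hi[of "M - int t + 2" "n"]
            lt[of "n-1"] n by (simp add: add.commute)
      with lt show ?case by (metis atLeastAtMost_iff le_neq_implies_less)
    qed
    show ?thesis
    proof (cases "j \<in> {1..n}")
      case True
      have "E j r = 0"
      proof (cases "r > M")
        case True
        then show ?thesis using M \<open>j \<in> {1..n}\<close> by auto
      next
        case False
        then have "r = M - int (nat (M - r))" by auto
        then show ?thesis using main \<open>j \<in> {1..n}\<close> by (metis atLeastAtMost_iff le0)
      qed
      then show ?thesis by (simp add: E_def)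
    qed (use out in \<open>auto simp: ctilde_sol_def\<close>)
  qed (use out in \<open>auto simp: ctilde_sol_def\<close>)
  then show ?case by blast
qed

lemma ctilde_row:
  assumes "n \<ge> 2" "1 \<le> j" "j < n" "i \<in> {1..n}"
  shows "ctilde n j i (m - 2) + ctilde n j i (m + 2)
     = ctilde n (j - 1) i m + ctilde n (j + 1) i m + (if j = i \<and> m = 0 then 1 else 0)"
  using ctilde_sol_row[OF assms, of m] assms ctilde_eq by simp

lemma ctilde_last_row:
  assumes "n \<ge> 2" "i \<in> {1..n}"
  shows "ctilde n n i (m - 1) + ctilde n n i (m + 1)
     = ctilde n (n - 1) i (m - 1) + ctilde n (n - 1) i (m + 1) + (if n = i \<and> m = 0 then 1 else 0)"
  using ctilde_sol_last_row[OF assms, of m] assms ctilde_eq by simp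

text \<open>The coefficient of z^m in (z^d - z^-d) F_ji, where F = C(z)^-1 and d = r_j. This product
  is symmetric in i and j although F is not, and gamma is its antisymmetrization in m.\<close>

definition ctilde_diff :: "nat \<Rightarrow> nat \<Rightarrow> nat \<Rightarrow> int \<Rightarrow> int" where
  "ctilde_diff n j i m = ctilde n j i (m - rB n j) - ctilde n j i (m + rB n j)"

lemma gammaB_conv: "gammaB n (i, r) (j, s) = ctilde_diff n j i (s - r) - ctilde_diff n j i (r - s)"
  by (simp add: gammaB_def ctilde_diff_def algebra_simps)

lemma ctilde_sol_last_column:
  assumes "n \<ge> 2" "1 \<le> j" "j < n"
  shows "ctilde_sol n j n (m - 1) + ctilde_sol n j n (m + 1) = ctilde_sol n j (n - 1) m"
proof (cases "even m")
  case True
  have j: "min j (n-1) = j" using assms by auto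
  note od = ctilde_sol_odd[of j n] and ev = ctilde_sol_even[of j n "n-1"]
  from True show ?thesis
  proof (cases rule: int_even_cases)
    case 1
    then show ?thesis by (simp add: ctilde_sol_pos)
  next
    case 2
    then show ?thesis by (simp add: ctilde_sol_pos)
  next
    case 3
    then show ?thesis using od[of 0] assms j by (simp add: ctilde_sol_pos ctilde_sol_zero)
  next
    case (4 t)
    have m: "m - 1 = - 2 * int (Suc t) - 1" "m + 1 = - 2 * int t - 1" using 4 by auto
    have "j \<in> {1..n}" "n - 1 \<in> {1..<n}" "j \<noteq> n" using assms by auto
    then show ?thesis
      unfolding m using od[of "Suc t"] od[of t] ev[of "Suc t"] unfolding 4 by (simp add: j)
  qed
qed (use assms in \<open>auto simp: ctilde_sol_parity\<close>)

text \<open>With F = C(z)^-1: (z^2 - z^-2) F_jn = (z - z^-1)(z + z^-1) F_jn = (z - z^-1) F_(j,n-1),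
  and F_(j,n-1) = F_(n-1,j) = F_nj.\<close>

lemma ctilde_diff_last:
  assumes "n \<ge> 2" "1 \<le> j" "j < n"
  shows "ctilde_diff n j n m = ctilde_diff n n j m"
proof -
  have A: "ctilde_sol n n j x = ctilde_sol n j (n - 1) x" for x
    using assms by (auto simp: ctilde_sol_def intro: cheb_sym)
  have "ctilde_diff n j n m = ctilde_sol n j n (m - 2) - ctilde_sol n j n (m + 2)"
    using assms by (simp add: ctilde_diff_def ctilde_eq rB_def)
  also have "\<dots> = ctilde_sol n j (n - 1) (m - 1) - ctilde_sol n j (n - 1) (m + 1)"
    using ctilde_sol_last_column[OF assms, of "m - 1"] ctilde_sol_last_column[OF assms, of "m + 1"] by (simp add: add.commute)
  also have "\<dots> = ctilde_diff n n j m"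
    using assms by (simp add: ctilde_diff_def ctilde_eq rB_def A)
  finally show ?thesis .
qed

lemma ctilde_diff_sym:
  assumes "n \<ge> 2" "i \<in> {1..n}" "j \<in> {1..n}"
  shows "ctilde_diff n j i m = ctilde_diff n i j m"
proof -
  consider "i = n" "j = n" | "i = n" "j < n" | "i < n" "j = n" | "i < n" "j < n"
    using assms by force
  then show ?thesis
  proof cases
    case 4
    then have "min i (n-1) = i" "min j (n-1) = j" by auto
    then have "ctilde_sol n i j x = ctilde_sol n j i x" for x
      using assms 4 by (auto simp: ctilde_sol_def intro: cheb_sym)
    then show ?thesis using 4 assms by (simp add: ctilde_diff_def ctilde_eq rB_def)
  qed (use assms ctilde_diff_last[of n i m] ctilde_diff_last[of n j m] in auto)
qed

lemma gammaB_antisym: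
  assumes "n \<ge> 2" "fst x \<in> {1..n}" "fst y \<in> {1..n}"
  shows "gammaB n x y = - gammaB n y x"
  using assms by (cases x, cases y) (simp add: gammaB_conv ctilde_diff_sym)

lemma gammaB_self: "gammaB n x x = 0"
  by (cases x) (simp add: gammaB_conv)

section \<open>Degree bounds and vanishing of the inverse\<close>

lemma ctilde_top_degree:
  assumes "n \<ge> 2" "i \<in> {1..n}" "j \<in> {1..n}" "m > - rB n j \<or> (m = - rB n j \<and> i \<noteq> j)"
  shows "ctilde n j i m = 0"
proof -
  consider "m > 0" | "m = 0" | "m = -1" | "m = -2" using assms(4) by (force simp: rB_def split: if_splits)
  then have "ctilde_sol n j i m = 0"
  proof cases
    case 3
    then show ?thesis using assms ctilde_sol_odd[of j n 0]
      by (cases "i < n"; cases "j < n") (auto simp: ctilde_sol_parity rB_def)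
  next
    case 4
    then show ?thesis using assms ctilde_sol_even[of j n i 1]
      by (cases "i < n"; cases "j < n") (auto simp: ctilde_sol_parity rB_def)
  qed (auto simp: ctilde_sol_pos ctilde_sol_zero)
  then show ?thesis using assms ctilde_eq by simp
qed

text \<open>Entries have degree at most -r_j, with equality only on the diagonal. For two distinct
  vertices taken in weakly decreasing height, one half of gamma disappears for this reason.\<close>

lemma ctilde_diff_pos:
  assumes "n \<ge> 2" "i \<in> {1..n}" "j \<in> {1..n}" "m > 0 \<or> (m = 0 \<and> i \<noteq> j)"
  shows "ctilde_diff n j i m = 0"
proof -
  have "rB n j > 0" by (simp add: rB_def)
  then show ?thesis unfolding ctilde_diff_def using ctilde_top_degree[OF assms(1-3)] assms(4) by auto
qed

lemma ctilde_diag_leading: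
  assumes "n \<ge> 2" "i \<in> {1..n}"
  shows "ctilde n i i (- rB n i) = 1"
proof (cases "i < n")
  case True
  then show ?thesis using ctilde_sol_even[of i n i 1] assms ctilde_eq[of n] by (auto simp: rB_def)
next
  case False
  then have "i = n" using assms by simp
  then show ?thesis using ctilde_sol_odd[of n n 0] assms ctilde_eq[of n] by (auto simp: rB_def)
qed

text \<open>All four bounds say m > -d, where d is the distance of two columns on a line
  (\<open>col_pos\<close>): both on the same side of the middle, on opposite sides, or one of them
  the middle column. They translate walk lengths into degrees, and the start of the recursion needs
  them in this sharp form.\<close>

lemma ctilde_vanish:
  assumes n: "n \<ge> 2" and "1 \<le> j" "j < n" "1 \<le> i" "i < n"
  shows "m - 2 > - 2 * (\<bar>int i - int j\<bar> + 1) \<Longrightarrow> ctilde n j i (m - 2) = 0"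
    and "m - 2 > - 2 * (2 * int n - int i - int j) \<Longrightarrow> (2 * (int i + int j + 1) - m) mod 4 = 0 
        \<Longrightarrow> ctilde n j i (m - 2) = 0"
    and "m > - (2 * (int n - int i) - 1) \<Longrightarrow> ctilde n n i (m - 1) = 0"
    and "m > - (2 * (int n - int j) - 1) \<Longrightarrow> ctilde n j n (m - 2) = 0"
proof -
  have mj: "min j (n-1) = j" using assms by auto
  have red: "ctilde_sol n j' i x = 0"
    if "\<And>t. x = -2 * int t \<Longrightarrow> cheb n t (min j' (n-1)) i = 0" "j' \<in> {1..n}" for x j'
  proof -
    have i: "i \<in> {1..<n}" "i \<in> {1..n}" using assms by auto
    show ?thesis
    proof (cases "even x \<and> x \<le> 0")
      case True
      then obtain b where "x = 2 * b" by (elim conjE evenE)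
      then have "x = -2 * int (nat (- b))" using True by simp
      then obtain t where "x = -2 * int t" by blast
      then show ?thesis using that ctilde_sol_even[OF \<open>j' \<in> {1..n}\<close> i(1)] by metis
    next
      case False
      then show ?thesis using ctilde_sol_parity[of i n x j'] ctilde_sol_pos[of x n j' i] i by auto
    qed
  qed
  show "ctilde n j i (m - 2) = 0" if "m - 2 > - 2 * (\<bar>int i - int j\<bar> + 1)"
    unfolding ctilde_eq[OF n] by (rule red) (use that assms mj in \<open>auto intro!: cheb_vanish\<close>)
  show "ctilde n j i (m - 2) = 0" if h: "m - 2 > - 2 * (2 * int n - int i - int j)"
      "(2 * (int i + int j + 1) - m) mod 4 = 0"
    unfolding ctilde_eq[OF n]
  proof (rule red)
    fix t assume t: "m - 2 = - 2 * int t"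
    obtain q where "2 * (int i + int j + 1) - m = 4 * q" using h(2) by (auto elim!: dvdE simp: mod_eq_0_iff_dvd)
    \<comment> \<open>The congruence says i + j + t = 2q, the wrong parity for a walk of length t -
      1 that avoids the loop.\<close>
    then have "int t - int i + int j = 2 * (q - int i)" using t by presburger
    then have "even (int t - int i + int j)" by (rule dvdI)
    moreover have "t + i + j + 1 \<le> 2 * n" using h(1) t by (simp flip: of_nat_le_iff)
    ultimately show "cheb n t (min j (n-1)) i = 0" using assms mj by (auto intro!: cheb_vanish)
  qed (use assms in auto)
  show "ctilde n n i (m - 1) = 0" if "m > - (2 * (int n - int i) - 1)"
    unfolding ctilde_eq[OF n] by (rule red) (use that assms mj in \<open>auto intro!: cheb_vanish\<close>)
  show "ctilde n j n (m - 2) = 0" if "m > - (2 * (int n - int j) - 1)"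
  proof (cases "odd m \<and> m - 2 \<le> 0")
    case True
    then obtain t where t: "m - 2 = - 2 * int t - 1"
      by (intro that[of "nat ((1 - m) div 2)"]) (auto elim!: oddE)
    then have "nat ((- (m-2) - 1) div 2) + j < n" unfolding t using that t by simp
    then show ?thesis using assms mj by (auto simp: ctilde_sol_def ctilde_eq[OF n] intro: cheb_alt_vanish)
  qed (use assms in \<open>auto simp: ctilde_sol_def ctilde_eq[OF n]\<close>)
qed

section \<open>Roots and weights along a word\<close>

lemma sref_add: "sref i (\<lambda>x. u x + v x) = (\<lambda>x. sref i u x + sref i v x)"
  and sref_diff: "sref i (\<lambda>x. u x - v x) = (\<lambda>x. sref i u x - sref i v x)"
  by (auto simp: sref_def fun_eq_iff)

lemma wle_0: "wle w 0 v = v"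
  and wle_Suc: "wle w (Suc t) v = wle w t (sref (w (Suc t)) v)"
  by (simp_all add: wle_def)

lemma wle_add: "wle w t (\<lambda>x. u x + v x) = (\<lambda>x. wle w t u x + wle w t v x)"
  by (induction t arbitrary: u v) (simp_all add: wle_0 wle_Suc sref_add)

lemma wle_diff: "wle w t (\<lambda>x. u x - v x) = (\<lambda>x. wle w t u x - wle w t v x)"
  by (induction t arbitrary: u v) (simp_all add: wle_0 wle_Suc sref_diff)

lemma ipA_add_right: "ipA n u (\<lambda>x. v x + v' x) = ipA n u v + ipA n u v'"
  and ipA_diff_right: "ipA n u (\<lambda>x. v x - v' x) = ipA n u v - ipA n u v'"
  and ipA_commute: "ipA n u v = ipA n v u"
  by (simp_all add: ipA_def algebra_simps sum.distrib sum_subtractf)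

lemma ipA_sum_left: "ipA n (\<lambda>x. \<Sum>k\<in>A. u k x) v = (\<Sum>k\<in>A. ipA n (u k) v)"
  unfolding ipA_def by (simp add: sum_distrib_right) (rule sum.swap)

lemma ipA_zero_right: "(\<And>x. x \<in> {1..2*n} \<Longrightarrow> v x = 0) \<Longrightarrow> ipA n u v = 0"
  by (simp add: ipA_def)

lemma ipA_sref:
  assumes "1 \<le> i" "i < 2 * n"
  shows "ipA n (sref i u) (sref i v) = ipA n u v"
proof -
  define p where "p x = (if x = i then i + 1 else if x = i + 1 then i else x)" for x
  have p: "bij_betw p {1..2*n} {1..2*n}"
    by (rule bij_betw_byWitness[where f' = p]) (use assms in \<open>auto simp: p_def\<close>)
  have "sref i f x = f (p x)" for f x by (auto simp: sref_def p_def)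
  then show ?thesis unfolding ipA_def
    using sum.reindex_bij_betw[OF p, of "\<lambda>x. u x * v x"] by simp
qed

definition simple_letters :: "nat \<Rightarrow> (nat \<Rightarrow> nat) \<Rightarrow> nat \<Rightarrow> bool" where
  "simple_letters n w t \<longleftrightarrow> (\<forall>s\<in>{1..t}. w s \<in> {1..<2*n})"

lemma simple_letters_Suc: "simple_letters n w (Suc t) \<Longrightarrow> simple_letters n w t"
  and simple_letters_last: "simple_letters n w (Suc t) \<Longrightarrow> w (Suc t) \<in> {1..<2*n}"
  and simple_letters_mono: "simple_letters n w t \<Longrightarrow> s \<le> t \<Longrightarrow> simple_letters n w s"
  by (auto simp: simple_letters_def)

lemma ipA_wle:
  "simple_letters n w t \<Longrightarrow> ipA n (wle w t u) (wle w t v) = ipA n u v"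
proof (induction t arbitrary: u v)
  case (Suc t)
  then show ?case using simple_letters_last[of n w t] simple_letters_Suc[of n w t]
    by (simp add: wle_Suc ipA_sref)
qed (simp add: wle_0)

text \<open>Weights are functions on all natural numbers, but only coordinates 1, ..., 2n are
  meaningful: \<open>fw n 0\<close> is 1 at coordinate 0. Vanishing is therefore always meant on
  these coordinates, which the letters permute.\<close>

lemma wle_zero:
  "simple_letters n w t \<Longrightarrow> (\<And>x. x \<in> {1..2*n} \<Longrightarrow> v x = 0) \<Longrightarrow> x \<in> {1..2*n} \<Longrightarrow> wle w t v x = 0"
proof (induction t arbitrary: v)
  case (Suc t)
  have "wle w t (sref (w (Suc t)) v) x = 0"
    by (rule Suc.IH)
      (use Suc.prems simple_letters_last[of n w t] simple_letters_Suc[of n w t] in \<open>auto simp: sref_def\<close>)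
  then show ?case by (simp add: wle_Suc)
qed (simp add: wle_0)

lemma fw_end: "x \<in> {1..2*n} \<Longrightarrow> fw n 0 x = 0" "x \<in> {1..2*n} \<Longrightarrow> fw n (2*n) x = 0"
  by (auto simp: fw_def)

lemma sref_fw_other: "j \<noteq> i \<Longrightarrow> sref i (fw n j) = fw n j"
  by (auto simp: sref_def fw_def fun_eq_iff)

lemma sref_fw_same:
  assumes "1 \<le> i" 
  shows "sref i (fw n i) = (\<lambda>x. fw n (i - 1) x + fw n (i + 1) x - fw n i x)"
  using assms by (auto simp: sref_def fw_def fun_eq_iff of_nat_diff diff_divide_distrib add_divide_distrib)

lemma ipA_simple_root:
  assumes "1 \<le> i" "i < 2 * n"
  shows "ipA n (\<lambda>x. fw n i x - sref i (fw n i) x) v = v i - v (i + 1)"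
proof -
  have "fw n i x - sref i (fw n i) x = (if x = i then 1 else 0) - (if x = i + 1 then 1 else 0)" for x
    by (auto simp: sref_def fw_def)
  then have "ipA n (\<lambda>x. fw n i x - sref i (fw n i) x) v
     = (\<Sum>x\<in>{1..2*n}. (if x = i then v x else 0) - (if x = i + 1 then v x else 0))"
    unfolding ipA_def by (intro sum.cong) auto
  also have "\<dots> = v i - v (i + 1)"
    using assms by (simp add: sum_subtractf)
  finally show ?thesis .
qed

text \<open>Since varpi_i - s_i varpi_i = alpha_i, this is beta_k. Written as a difference of
  weights it makes sums over a column telescope.\<close>

definition word_root :: "nat \<Rightarrow> (nat \<Rightarrow> nat) \<Rightarrow> nat \<Rightarrow> nat \<Rightarrow> rat" where
  "word_root n w k = (\<lambda>x. wle w (k - 1) (fw n (w k)) x - wle w k (fw n (w k)) x)"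

definition root_weight :: "nat \<Rightarrow> (nat \<Rightarrow> nat) \<Rightarrow> nat \<Rightarrow> nat \<Rightarrow> nat \<Rightarrow> rat" where
  "root_weight n w k t j = ipA n (word_root n w k) (wle w t (fw n j))"

lemma root_weight_end:
  assumes "simple_letters n w t"
  shows "root_weight n w k t 0 = 0" "root_weight n w k t (2*n) = 0"
  unfolding root_weight_def
  using assms by (auto intro!: ipA_zero_right wle_zero[where n=n] fw_end)

lemma root_weight_Suc:
  assumes "simple_letters n w (Suc t)"
  shows "root_weight n w k (Suc t) j =
    (if j = w (Suc t) then root_weight n w k t (j - 1) + root_weight n w k t (j + 1) - root_weight n w k t j
     else root_weight n w k t j)"
proof (cases "j = w (Suc t)")
  case True
  have "1 \<le> w (Suc t)" using simple_letters_last[OF assms] by simp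
  from sref_fw_same[OF this, of n] show ?thesis
    using True by (simp add: root_weight_def wle_Suc wle_add wle_diff ipA_add_right ipA_diff_right)
qed (simp add: root_weight_def wle_Suc sref_fw_other)

text \<open>By invariance the pairing is that of a simple root alpha with varpi_j; the reflection at
  step k replaces alpha by -alpha.\<close>

lemma root_weight_start:
  assumes "simple_letters n w k" "1 \<le> k"
  shows "root_weight n w k (k - 1) j = (if j = w k then 1 else 0)"
    and "root_weight n w k k j = (if j = w k then - 1 else 0)"
proof -
  obtain t where k: "k = Suc t" using assms(2) by (cases k) auto
  have i: "1 \<le> w k" "w k < 2 * n" using simple_letters_last[of n w t] assms k by auto
  have b: "word_root n w k = wle w t (\<lambda>x. fw n (w k) x - sref (w k) (fw n (w k)) x)"
    by (simp add: word_root_def k wle_Suc wle_diff)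
  have *: "root_weight n w k (k - 1) j = (if j = w k then 1 else 0)"  for j
    unfolding root_weight_def b using simple_letters_Suc[of n w t] assms k i
    by (simp add: ipA_wle ipA_simple_root) (auto simp: fw_def)
  show "root_weight n w k (k - 1) j = (if j = w k then 1 else 0)" by (rule *)
  have "root_weight n w k k j = ipA n (\<lambda>x. fw n (w k) x - sref (w k) (fw n (w k)) x) (sref (w k) (fw n j))"
    unfolding root_weight_def b using simple_letters_Suc[of n w t] assms k by (simp add: ipA_wle wle_Suc)
  then show "root_weight n w k k j = (if j = w k then - 1 else 0)"
    using i by (simp add: ipA_simple_root) (auto simp: fw_def sref_def)
qed

lemma ipA_word_root:
  "ipA n (word_root n w k) (word_root n w l) = root_weight n w k (l - 1) (w l) - root_weight n w k l (w l)"
  by (simp add: root_weight_def word_root_def[of n w l] ipA_diff_right)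

lemma weight_telescope:
  "fw n j x - wle w t (fw n j) x = (\<Sum>l\<in>{l\<in>{1..t}. w l = j}. word_root n w l x)"
proof (induction t)
  case (Suc t)
  have s: "{l\<in>{1..Suc t}. w l = j} = {l\<in>{1..t}. w l = j} \<union> (if w (Suc t) = j then {Suc t} else {})"
    by (auto simp: le_Suc_eq)
  show ?case
  proof (cases "w (Suc t) = j")
    case True
    then show ?thesis unfolding s using Suc
      by (subst sum.union_disjoint) (auto simp: word_root_def)
  next
    case False
    then show ?thesis unfolding s using Suc by (simp add: wle_Suc sref_fw_other)
  qed
qed (simp add: wle_0)

section \<open>The skew pairing of roots and the matrix Lambda\<close>

definition signed_form :: "nat \<Rightarrow> (nat \<Rightarrow> nat) \<Rightarrow> nat \<Rightarrow> nat \<Rightarrow> rat" where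
  "signed_form n w k l = (if k < l then 1 else if l < k then -1 else 0)
      * ipA n (word_root n w k) (word_root n w l)"

text \<open>Let p_t be the pairing of beta_k with w_(<=t) varpi_j. Indices l < k contribute p_(k-1)
  - p_0, indices l > k contribute p_k - p_t, and p_(k-1) + p_k = 0 by the sign change at step k.
  What remains is -(p_0 + p_t), which accounts for the plus sign in the definition of
  lambda.\<close>

lemma signed_form_sum:
  assumes "1 \<le> k" "k \<le> t" "simple_letters n w t"
  shows "(\<Sum>l\<in>{l\<in>{1..t}. w l = j}. signed_form n w k l)
    = - ipA n (word_root n w k) (\<lambda>x. fw n j x + wle w t (fw n j) x)"
  using assms(2,3)
proof (induction t rule: dec_induct)
  case base
  have "(\<Sum>l\<in>{l\<in>{1..k}. w l = j}. signed_form n w k l)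
     = (\<Sum>l\<in>{l\<in>{1..k-1}. w l = j}. - ipA n (word_root n w k) (word_root n w l))"
    by (rule sum.mono_neutral_cong_right) (auto simp: signed_form_def)
  also have "\<dots> = - ipA n (word_root n w k) (\<lambda>x. \<Sum>l\<in>{l\<in>{1..k-1}. w l = j}. word_root n w l x)"
    by (simp add: ipA_commute[of n "word_root n w k"] ipA_sum_left sum_negf)
  also have "\<dots> = - ipA n (word_root n w k) (fw n j) + root_weight n w k (k-1) j"
    unfolding weight_telescope[symmetric] by (simp add: ipA_diff_right root_weight_def)
  also have "\<dots> = - ipA n (word_root n w k) (fw n j) - root_weight n w k k j"
    using root_weight_start[of n w k j] assms base by (simp split: if_splits)
  finally show ?case by (simp add: ipA_add_right root_weight_def)
next
  case (step t)
  have s: "{l\<in>{1..Suc t}. w l = j} = {l\<in>{1..t}. w l = j} \<union> (if w (Suc t) = j then {Suc t} else {})"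
    by (auto simp: le_Suc_eq)
  have IH: "(\<Sum>l\<in>{l\<in>{1..t}. w l = j}. signed_form n w k l)
    = - ipA n (word_root n w k) (fw n j) - root_weight n w k t j"
    using step simple_letters_Suc by (simp add: ipA_add_right root_weight_def)
  have "(\<Sum>l\<in>{l\<in>{1..Suc t}. w l = j}. signed_form n w k l)
      = - ipA n (word_root n w k) (fw n j) - root_weight n w k (Suc t) j"
  proof (cases "w (Suc t) = j")
    case True
    have "signed_form n w k (Suc t) = root_weight n w k t j - root_weight n w k (Suc t) j"
      using step True by (simp add: signed_form_def ipA_word_root)
    then show ?thesis unfolding s using IH True by (subst sum.union_disjoint) auto
  next
    case False
    then show ?thesis unfolding s using IH by (simp add: root_weight_def wle_Suc sref_fw_other)
  qed
  then show ?case by (simp add: ipA_add_right root_weight_def)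
qed

lemma ipA_minuscule_pairing:
  assumes "s \<le> t" "simple_letters n w t"
  shows "ipA n (\<lambda>x. fw n i x - wle w s (fw n i) x) (\<lambda>x. fw n j x + wle w t (fw n j) x)
    = - (\<Sum>k\<in>{k\<in>{1..s}. w k = i}. \<Sum>l\<in>{l\<in>{1..t}. w l = j}. signed_form n w k l)"
proof -
  have "(\<Sum>k\<in>{k\<in>{1..s}. w k = i}. \<Sum>l\<in>{l\<in>{1..t}. w l = j}. signed_form n w k l)
    = (\<Sum>k\<in>{k\<in>{1..s}. w k = i}. - ipA n (word_root n w k) (\<lambda>x. fw n j x + wle w t (fw n j) x))"
    by (intro sum.cong signed_form_sum refl) (use assms in auto)
  then show ?thesis unfolding weight_telescope by (simp add: ipA_sum_left sum_negf)
qed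

text \<open>Integrality of the signed pairings makes the floor in \<open>lam\<close> harmless, and
  their skewness carries the formula from s < t over to all pairs.\<close>

lemma LamM_eq:
  fixes \<sigma> :: "nat \<Rightarrow> nat \<Rightarrow> int"
  assumes "s \<le> m" "t \<le> m" "simple_letters n w m"
    and \<sigma>: "\<And>k l. 1 \<le> k \<Longrightarrow> k \<le> m \<Longrightarrow> 1 \<le> l \<Longrightarrow> l \<le> m \<Longrightarrow> signed_form n w k l = of_int (\<sigma> k l)"
  shows "LamM n w s t = - (\<Sum>k\<in>{k\<in>{1..s}. w k = w s}. \<Sum>l\<in>{l\<in>{1..t}. w l = w t}. \<sigma> k l)"
proof -
  define S where "S s t = (\<Sum>k\<in>{k\<in>{1..s}. w k = w s}. \<Sum>l\<in>{l\<in>{1..t}. w l = w t}. \<sigma> k l)" for s t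
  have lam: "lam n w s t = - S s t" if "s \<le> t" "t \<le> m" for s t
  proof -
    have "(\<Sum>k\<in>{k\<in>{1..s}. w k = w s}. \<Sum>l\<in>{l\<in>{1..t}. w l = w t}. signed_form n w k l) = of_int (S s t)"
      unfolding S_def of_int_sum using that by (intro sum.cong refl \<sigma>) auto
    then show ?thesis unfolding lam_def
      using ipA_minuscule_pairing[OF that(1), of n w] simple_letters_mono[OF assms(3) that(2)]
      by (simp flip: of_int_minus)
  qed
  have "signed_form n w k l = - signed_form n w l k" for k l
    using ipA_commute[of n "word_root n w k"] by (auto simp: signed_form_def)
  then have anti: "\<sigma> k l = - \<sigma> l k" if "1 \<le> k" "k \<le> m" "1 \<le> l" "l \<le> m" for k l
    using \<sigma>[OF that] \<sigma>[OF that(3,4,1,2)] by (metis of_int_eq_iff of_int_minus)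
  have S: "S s t = - S t s" if "s \<le> m" "t \<le> m" for s t
  proof -
    have "S s t = (\<Sum>k\<in>{k\<in>{1..s}. w k = w s}. \<Sum>l\<in>{l\<in>{1..t}. w l = w t}. - \<sigma> l k)"
      unfolding S_def using that by (intro sum.cong refl anti) auto
    also have "\<dots> = - S t s" unfolding S_def sum_negf by (simp, rule sum.swap)
    finally show ?thesis .
  qed
  have "S s s = 0" using S[of s s] assms by simp
  then have "LamM n w s t = - S s t"
    using lam[of s t] lam[of t s] S[of s t] assms(1,2)
    by (cases s t rule: linorder_cases) (auto simp: LamM_def)
  then show ?thesis by (simp add: S_def)
qed

section \<open>The columns of the twisted set\<close>

definition fold_col :: "nat \<Rightarrow> nat \<Rightarrow> nat" where
  "fold_col n \<iota> = (if \<iota> \<le> n then \<iota> else 2 * n - \<iota>)"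

definition col_step :: "nat \<Rightarrow> nat \<Rightarrow> int" where
  "col_step n \<iota> = (if \<iota> = n then 2 else 4)"

text \<open>In doubled heights the half-integral middle column is odd. With M the larger of the two
  middle heights its top is 2M + 1 or 2M - 1, as the extra vertex is added above or below. A column
  iota > n comes from the quiver vertex iota - 1.\<close>

definition col_top :: "nat \<Rightarrow> (nat \<Rightarrow> int) \<Rightarrow> bool \<Rightarrow> nat \<Rightarrow> int" where
  "col_top n \<xi> gt \<iota> =
    (if \<iota> < n then 2 * \<xi> \<iota>
     else if \<iota> = n then 2 * max (\<xi> (n - 1)) (\<xi> n) + (if gt then 1 else -1)
     else 2 * \<xi> (\<iota> - 1))"

text \<open>A strict lower bound.\<close>
definition col_low :: "nat \<Rightarrow> (nat \<Rightarrow> int) \<Rightarrow> bool \<Rightarrow> nat \<Rightarrow> int" where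
  "col_low n \<xi> gt \<iota> =
    (if \<iota> < n then 2 * \<xi> (2 * n - 1 - \<iota>) else if \<iota> = n then col_top n \<xi> gt n
     else 2 * \<xi> (2 * n - \<iota>)) - 4 * int n + 2"

lemma fold_col_range: "\<iota> \<in> {1..<2*n} \<Longrightarrow> fold_col n \<iota> \<in> {1..n}"
  by (auto simp: fold_col_def)

lemma col_step_rB: "col_step n \<iota> = 2 * rB n (fold_col n \<iota>)" if "\<iota> \<in> {1..<2*n}"
  using that by (auto simp: col_step_def fold_col_def rB_def)

lemma ovl_eq: "ovl n (\<iota>, r) = (fold_col n \<iota>, r)"
  by (simp add: ovl_def fold_col_def)

text \<open>Pins down a front as the only member of its residue class in the window from r
  (excluded) to r + c (included).\<close>

lemma next_multiple_unique:
  fixes c :: int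
  assumes "c dvd a - x" "c dvd a - y" "r < x" "y - c \<le> r"
  shows "y \<le> x"
proof (rule ccontr)
  assume "\<not> y \<le> x"
  have "c dvd (a - x) - (a - y)" by (rule dvd_diff[OF assms(1,2)])
  then have "c dvd y - x" by simp
  then have "c \<le> y - x" using \<open>\<not> y \<le> x\<close> by (intro zdvd_imp_le) auto
  then show False using assms by linarith
qed

lemma max_diff_one_cases:
  fixes x y :: int
  assumes "x = y + 1 \<or> y = x + 1"
  shows "(x = y + 1 \<and> max y x = x) \<or> (y = x + 1 \<and> max y x = y)"
  using assms by auto

lemma height_step:
  assumes "typeA_quiver m arr" "height_fn arr \<xi>" "1 \<le> i" "i < m"
  shows "\<bar>\<xi> (i + 1) - \<xi> i\<bar> = 1"
proof -
  have "arr i (i + 1) \<or> arr (i + 1) i" using assms unfolding typeA_quiver_def by blast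
  moreover have "\<xi> k = \<xi> j + 1" if "arr j k" for j k using assms that unfolding height_fn_def by blast
  ultimately show ?thesis by fastforce
qed

locale twisted_word =
  fixes n :: nat and \<xi> :: "nat \<Rightarrow> int" and gt :: bool and pos :: "nat \<Rightarrow> nat \<times> int"
  assumes n_ge: "n \<ge> 2"
    and step_height: "1 \<le> i \<Longrightarrow> i < 2 * n - 2 \<Longrightarrow> \<bar>\<xi> (i + 1) - \<xi> i\<bar> = 1"
    and pos_bij: "bij_betw pos {1..ellB n} (hatItw n \<xi> gt)"
    and pos_sorted: "1 \<le> s \<Longrightarrow> s < t \<Longrightarrow> t \<le> ellB n \<Longrightarrow> snd (pos t) \<le> snd (pos s)"
begin

abbreviation "T \<equiv> hatItw n \<xi> gt"
abbreviation "ell \<equiv> ellB n"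
abbreviation "w \<equiv> \<lambda>s. fst (pos s)"
abbreviation "ht \<equiv> \<lambda>s. snd (pos s)"
abbreviation "ctop \<equiv> col_top n \<xi> gt"
abbreviation "clow \<equiv> col_low n \<xi> gt"
abbreviation "cstep \<equiv> col_step n"
abbreviation "fld \<equiv> fold_col n"

section \<open>Heights, congruences and the shape of each column\<close>

lemma height_diff:
  assumes "1 \<le> a" "a \<le> b" "b \<le> 2 * n - 2"
  shows "\<bar>\<xi> b - \<xi> a\<bar> \<le> int b - int a \<and> (even (\<xi> b - \<xi> a) \<longleftrightarrow> even (b - a))"
  using assms(2,3)
proof (induction b rule: dec_induct)
  case (step b)
  have "\<bar>\<xi> (b + 1) - \<xi> b\<bar> = 1" using step_height[of b] step assms by simp
  then consider "\<xi> (b + 1) = \<xi> b + 1" | "\<xi> (b + 1) = \<xi> b - 1" by linarith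
  then show ?case using step by cases (auto simp: Suc_diff_le)
qed simp

lemma height_lipschitz:
  assumes "a \<in> {1..2*n-2}" "b \<in> {1..2*n-2}"
  shows "\<bar>\<xi> b - \<xi> a\<bar> \<le> \<bar>int b - int a\<bar>"
  using height_diff[of a b] height_diff[of b a] assms by (cases "a \<le> b") auto

lemma height_parity:
  assumes "a \<in> {1..2*n-2}" "b \<in> {1..2*n-2}"
  shows "even (\<xi> b - \<xi> a) \<longleftrightarrow> even (int b - int a)"
  using height_diff[of a b] height_diff[of b a] assms by (cases "a \<le> b") auto

lemma middle_height: "\<bar>\<xi> n - \<xi> (n - 1)\<bar> = 1"
  using step_height[of "n - 1"] n_ge by simp

text \<open>The involution i -> 2n - 1 - i swaps n - 1 and n, whose heights differ by 1; up to
  parity both ranges then have the same bounds in terms of the maximum M.\<close>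

lemma hatI_middle:
  defines "M \<equiv> max (\<xi> (n - 1)) (\<xi> n)"
  shows "(n - 1, p) \<in> hatI n \<xi> \<longleftrightarrow> even (p - \<xi> (n - 1)) \<and> M - 2 * int n + 2 \<le> p \<and> p \<le> M"
    and "(n, p) \<in> hatI n \<xi> \<longleftrightarrow> even (p - \<xi> n) \<and> M - 2 * int n + 2 \<le> p \<and> p \<le> M"
proof -
  have e: "2 * n - 1 - (n - 1) = n" "2 * n - 1 - n = n - 1" using n_ge by auto
  have par: "x mod 2 = y mod 2 \<longleftrightarrow> even (x - y)" for x y :: int
    by (simp add: mod_eq_dvd_iff)
  from middle_height consider "\<xi> n = \<xi> (n - 1) + 1" | "\<xi> (n - 1) = \<xi> n + 1" by linarith
  note cs = this
  from cs show "(n - 1, p) \<in> hatI n \<xi> \<longleftrightarrow> even (p - \<xi> (n - 1)) \<and> M - 2 * int n + 2 \<le> p \<and> p \<le> M"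
    unfolding hatI_def par M_def using n_ge by cases (auto simp: e, presburger+)
  from cs show "(n, p) \<in> hatI n \<xi> \<longleftrightarrow> even (p - \<xi> n) \<and> M - 2 * int n + 2 \<le> p \<and> p \<le> M"
    unfolding hatI_def par M_def using n_ge by cases (auto simp: e, presburger+)
qed

lemma middle_rows:
  defines "M \<equiv> max (\<xi> (n - 1)) (\<xi> n)"
  shows "{p. (n - 1, p) \<in> hatI n \<xi> \<or> (n, p) \<in> hatI n \<xi>} = {M - 2 * int n + 2..M}"
    and "{(n - 1, p - 1), (n, p)} \<subseteq> hatI n \<xi> \<or> {(n, p - 1), (n - 1, p)} \<subseteq> hatI n \<xi>
      \<longleftrightarrow> M - 2 * int n + 3 \<le> p \<and> p \<le> M"
proof -
  have o: "odd (\<xi> n - \<xi> (n - 1))" using middle_height by presburger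
  have *: "even (p - \<xi> (n - 1)) \<longleftrightarrow> odd (p - \<xi> n)" for p using o by presburger
  show "{p. (n - 1, p) \<in> hatI n \<xi> \<or> (n, p) \<in> hatI n \<xi>} = {M - 2 * int n + 2..M}"
    unfolding hatI_middle * M_def by auto
  show "{(n - 1, p - 1), (n, p)} \<subseteq> hatI n \<xi> \<or> {(n, p - 1), (n - 1, p)} \<subseteq> hatI n \<xi>
      \<longleftrightarrow> M - 2 * int n + 3 \<le> p \<and> p \<le> M"
    unfolding insert_subset hatI_middle * M_def[symmetric] simp_thms
    by (simp only: empty_subsetI simp_thms) presburger
qed

lemma rMax_rMin:
  "rMax n \<xi> = max (\<xi> (n - 1)) (\<xi> n)"
  "rMin n \<xi> = max (\<xi> (n - 1)) (\<xi> n) - 2 * int n + 2"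
  unfolding rMax_def rMin_def middle_rows using n_ge by (auto intro!: Max_eqI Min_eqI)

lemma hatI_double:
  assumes "1 \<le> i" "i \<le> 2 * n - 2"
  shows "(\<exists>p. r = 2 * p \<and> (i, p) \<in> hatI n \<xi>) \<longleftrightarrow>
    4 dvd 2 * \<xi> i - r \<and> 2 * \<xi> (2 * n - 1 - i) - 4 * int n + 2 < r \<and> r \<le> 2 * \<xi> i"
proof -
  have par: "x mod 2 = y mod 2 \<longleftrightarrow> even (x - y)" for x y :: int
    by (simp add: mod_eq_dvd_iff)
  have "4 dvd 2 * \<xi> i - r \<longleftrightarrow> (\<exists>p. r = 2 * p \<and> even (p - \<xi> i))" by presburger
  then show ?thesis using assms unfolding hatI_def par by auto
qed

text \<open>Every column is an unbroken arithmetic progression. In the middle one, rows n - 1 and n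
  together fill an interval and give 2n - 2 midpoints; the extra vertex prolongs them by one term at
  the chosen end.\<close>

lemma hatItw_iff:
  "(\<iota>, r) \<in> T \<longleftrightarrow> \<iota> \<in> {1..<2*n} \<and> cstep \<iota> dvd ctop \<iota> - r \<and> clow \<iota> < r \<and> r \<le> ctop \<iota>"
proof -
  consider "\<iota> = 0 \<or> \<iota> \<ge> 2 * n" | "1 \<le> \<iota>" "\<iota> < n" | "\<iota> = n" | "n < \<iota>" "\<iota> < 2 * n" by linarith
  then show ?thesis
  proof cases
    case 1
    have "1 \<le> i \<and> i \<le> 2 * n - 2" if "(i, p) \<in> hatI n \<xi>" for i p using that by (simp add: hatI_def)
    then have "(\<iota>, r) \<notin> T" using n_ge 1 unfolding hatItw_def by (auto split: if_splits) fastforce+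
    then show ?thesis using 1 by auto
  next
    case 2
    then have "(\<iota>, r) \<in> T \<longleftrightarrow> (\<exists>p. r = 2 * p \<and> (\<iota>, p) \<in> hatI n \<xi>)"
      by (auto simp: hatItw_def)
    then show ?thesis using hatI_double[of \<iota> r] 2
      by (auto simp: col_step_def col_top_def col_low_def)
  next
    case 3
    define M where "M = max (\<xi> (n - 1)) (\<xi> n)"
    have "(n, r) \<in> T \<longleftrightarrow> (\<exists>p. r = 2 * p - 1 \<and> M - 2 * int n + 3 \<le> p \<and> p \<le> M)
        \<or> r = (if gt then 2 * M + 1 else 2 * (M - 2 * int n + 2) - 1)"
      unfolding hatItw_def middle_rows rMax_rMin using n_ge by (auto simp: M_def)
    also have "\<dots> \<longleftrightarrow> 2 dvd 2 * M + (if gt then 1 else -1) - r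
        \<and> 2 * M + (if gt then 1 else -1) - 4 * int n + 2 < r \<and> r \<le> 2 * M + (if gt then 1 else -1)"
    proof -
      have "(\<exists>p. r = 2 * p - 1 \<and> K + 1 \<le> p \<and> p \<le> M) \<or> r = 2 * M + 1
          \<longleftrightarrow> even (2 * M + 1 - r) \<and> 2 * K - 1 < r \<and> r \<le> 2 * M + 1"
        "(\<exists>p. r = 2 * p - 1 \<and> K + 1 \<le> p \<and> p \<le> M) \<or> r = 2 * K - 1
          \<longleftrightarrow> even (2 * M - 1 - r) \<and> 2 * K - 3 < r \<and> r \<le> 2 * M - 1" if "K \<le> M" for K
        using that by presburger+
      from this[of "M - 2 * int n + 2"] show ?thesis using n_ge by (cases gt) (simp_all add: algebra_simps)
    qed
    finally show ?thesis using 3 n_ge by (simp add: col_step_def col_top_def col_low_def M_def)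
  next
    case 4
    then have "(\<iota>, r) \<in> T \<longleftrightarrow> (\<exists>p. r = 2 * p \<and> (\<iota> - 1, p) \<in> hatI n \<xi>)"
      by (auto simp: hatItw_def intro!: exI[of _ "\<iota> - 1"])
    moreover have "2 * n - 1 - (\<iota> - 1) = 2 * n - \<iota>" using 4 by simp
    ultimately show ?thesis using hatI_double[of "\<iota> - 1" r] 4
      by (auto simp: col_step_def col_top_def col_low_def)
  qed
qed

lemma pos_mem: "s \<in> {1..ell} \<Longrightarrow> pos s \<in> T"
  using pos_bij by (auto simp: bij_betw_def)

lemma pos_inj: "s \<in> {1..ell} \<Longrightarrow> t \<in> {1..ell} \<Longrightarrow> pos s = pos t \<Longrightarrow> s = t"
  using inj_onD[OF bij_betw_imp_inj_on[OF pos_bij]] by blast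

lemma pos_surj: "x \<in> T \<Longrightarrow> \<exists>s\<in>{1..ell}. pos s = x"
  using pos_bij by (force simp: bij_betw_def)

lemma letters: "s \<in> {1..ell} \<Longrightarrow> w s \<in> {1..<2*n}"
  using pos_mem[of s] hatItw_iff[of "w s" "ht s"] by simp

lemma simple_word: "simple_letters n w ell"
  using letters by (simp add: simple_letters_def)

lemma odd_middle_top: "odd (ctop n)"
  by (simp add: col_top_def)

lemma even_outer_top: "\<iota> \<noteq> n \<Longrightarrow> even (ctop \<iota>)"
  by (simp add: col_top_def)

text \<open>Columns iota and 2n - iota come from quiver vertices at odd distance, so their doubled
  heights lie in different classes mod 4. The hypotheses are about classes rather than membership in
  \<open>T\<close> because the count k(i, r) meets heights of which only the class is known.\<close>

lemma folded_lattice_inj: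
  assumes "\<iota> \<in> {1..<2*n}" "\<kappa> \<in> {1..<2*n}" "fld \<iota> = fld \<kappa>"
    and "cstep \<iota> dvd ctop \<iota> - r" "cstep \<kappa> dvd ctop \<kappa> - r"
  shows "\<iota> = \<kappa>"
proof (rule ccontr)
  assume "\<iota> \<noteq> \<kappa>"
  have *: False if "1 \<le> \<iota>" "\<iota> < n" "\<kappa> = 2 * n - \<iota>"
      "cstep \<iota> dvd ctop \<iota> - r" "cstep \<kappa> dvd ctop \<kappa> - r" for \<iota> \<kappa>
  proof -
    have k: "\<not> \<kappa> < n" "\<kappa> \<noteq> n" "\<iota> \<noteq> n" using that(1-3) by auto
    have "4 dvd 2 * \<xi> \<iota> - r" "4 dvd 2 * \<xi> (\<kappa> - 1) - r"
      using that(2,4,5) k by (auto simp: col_top_def col_step_def)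
    then have "even (\<xi> (\<kappa> - 1) - \<xi> \<iota>)" by presburger
    moreover have "\<iota> \<in> {1..2*n-2}" "\<kappa> - 1 \<in> {1..2*n-2}" using that(1-3) by auto
    ultimately have "even (int (\<kappa> - 1) - int \<iota>)" using height_parity by blast
    moreover have "int (\<kappa> - 1) - int \<iota> = 2 * (int n - int \<iota>) - 1" using that(2,3) by (simp add: of_nat_diff)
    ultimately have "even (2 * (int n - int \<iota>) - 1)" by metis
    then show False by simp
  qed
  have "\<iota> < n \<and> \<kappa> = 2 * n - \<iota> \<or> \<kappa> < n \<and> \<iota> = 2 * n - \<kappa>"
    using assms(1-3) \<open>\<iota> \<noteq> \<kappa>\<close> by (auto simp: fold_col_def split: if_splits)
  then show False using *[of \<iota> \<kappa>] *[of \<kappa> \<iota>] assms by auto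
qed

lemma folded_position_inj:
  assumes "(\<iota>, r) \<in> T" "(\<kappa>, r) \<in> T" "fld \<iota> = fld \<kappa>"
  shows "\<iota> = \<kappa>"
  using assms folded_lattice_inj[of \<iota> \<kappa> r] by (simp add: hatItw_iff)

text \<open>The height of the lowest vertex of each column among the first \<open>t\<close> letters; an untouched column
  starts one step above its top.\<close>
primrec front :: "nat \<Rightarrow> nat \<Rightarrow> int" where
  "front 0 = (\<lambda>\<iota>. ctop \<iota> + cstep \<iota>)"
| "front (Suc t) = (front t)(w (Suc t) := ht (Suc t))"

section \<open>Where the fronts stand when a vertex is placed\<close>

lemma front_cases:
  assumes "t \<le> ell"
  shows "(front t \<iota> = ctop \<iota> + cstep \<iota> \<and> (\<forall>s\<in>{1..t}. w s \<noteq> \<iota>)) \<or>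
    ((\<exists>s\<in>{1..t}. pos s = (\<iota>, front t \<iota>)) \<and> (\<forall>s\<in>{1..t}. w s = \<iota> \<longrightarrow> front t \<iota> \<le> ht s))"
  using assms
proof (induction t)
  case (Suc t)
  show ?case
  proof (cases "w (Suc t) = \<iota>")
    case True
    have "ht (Suc t) \<le> ht s" if "s \<in> {1..Suc t}" for s
      using pos_sorted[of s "Suc t"] that Suc.prems by (cases "s = Suc t") auto
    moreover have "pos (Suc t) = (\<iota>, front (Suc t) \<iota>)" using True by (simp add: prod_eq_iff)
    ultimately show ?thesis using True by fastforce
  next
    case False
    then show ?thesis using Suc by (fastforce simp: le_Suc_eq)
  qed
qed simp

text \<open>When a vertex of height r is placed, everything above r has been placed and nothing
  below r. So the front of column kappa is the next height N of its class above r, either a vertex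
  or the default one step above the top. The order among vertices of height r is free; the last
  hypothesis rules out that another column kappa has a vertex there.\<close>

lemma front_next:
  assumes "Suc t \<le> ell" "pos (Suc t) = (\<iota>, r)" "\<kappa> \<in> {1..<2*n}"
    and N: "cstep \<kappa> dvd ctop \<kappa> - N" "r < N" "N - cstep \<kappa> \<le> r" "clow \<kappa> < N" "N \<le> ctop \<kappa> + cstep \<kappa>"
    and "\<kappa> = \<iota> \<or> \<not> cstep \<kappa> dvd ctop \<kappa> - r"
  shows "front t \<kappa> = N"
proof -
  from front_cases[of t \<kappa>] assms(1)
  consider "front t \<kappa> = ctop \<kappa> + cstep \<kappa>" "\<forall>s\<in>{1..t}. w s \<noteq> \<kappa>"
    | s where "s \<in> {1..t}" "pos s = (\<kappa>, front t \<kappa>)" "\<forall>s\<in>{1..t}. w s = \<kappa> \<longrightarrow> front t \<kappa> \<le> ht s"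
    by force
  note cs = this
  have early: "\<exists>s\<in>{1..t}. pos s = (\<kappa>, N)" if "N \<le> ctop \<kappa>"
  proof -
    have "(\<kappa>, N) \<in> T" using that N assms(3) by (simp add: hatItw_iff)
    then obtain s where s: "s \<in> {1..ell}" "pos s = (\<kappa>, N)" using pos_surj by blast
    have "s < Suc t"
    proof (rule ccontr)
      assume "\<not> s < Suc t"
      then have "N \<le> r" using pos_sorted[of "Suc t" s] s assms(2) by (cases "s = Suc t") auto
      then show False using N by simp
    qed
    then show ?thesis using s by force
  qed
  from cs show ?thesis
  proof cases
    case 1
    then have "ctop \<kappa> < N" using early by force
    then show ?thesis using 1 next_multiple_unique[of "cstep \<kappa>" "ctop \<kappa>" N "ctop \<kappa> + cstep \<kappa>" "ctop \<kappa>"] N by auto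
  next
    case 2
    have st: "s \<in> {1..ell}" "Suc t \<in> {1..ell}" "s < Suc t" using 2 assms by auto
    have T: "(\<kappa>, front t \<kappa>) \<in> T" using 2 pos_mem[OF st(1)] by simp
    have "r \<le> front t \<kappa>" using pos_sorted[of s "Suc t"] 2 assms by auto
    moreover have "r \<noteq> front t \<kappa>"
    proof
      assume eq: "r = front t \<kappa>"
      then have "\<kappa> = \<iota>" using T assms by (auto simp: hatItw_iff)
      then show False using eq 2 assms pos_inj[OF st(1,2)] by auto
    qed
    ultimately have "N \<le> front t \<kappa>"
      using next_multiple_unique[of "cstep \<kappa>" "ctop \<kappa>" "front t \<kappa>" N r] N T by (auto simp: hatItw_iff)
    moreover have "front t \<kappa> \<le> N"
    proof (cases "N \<le> ctop \<kappa>")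
      case True
      then show ?thesis using early 2 by force
    next
      case False
      then show ?thesis using T by (simp add: hatItw_iff)
    qed
    ultimately show ?thesis by simp
  qed
qed

lemma step_pos: "cstep \<iota> > 0" by (simp add: col_step_def)

lemma front_same_column:
  assumes "Suc t \<le> ell" "pos (Suc t) = (\<iota>, r)"
  shows "front t \<iota> = r + cstep \<iota>"
proof -
  have T: "(\<iota>, r) \<in> T" using pos_mem[of "Suc t"] assms by simp
  have "cstep \<iota> dvd ctop \<iota> - r" using T by (simp add: hatItw_iff)
  then have "cstep \<iota> dvd (ctop \<iota> - r) - cstep \<iota>" by (rule dvd_diff) simp
  then have "cstep \<iota> dvd ctop \<iota> - (r + cstep \<iota>)" by (simp add: algebra_simps)
  then show ?thesis using assms T step_pos[of \<iota>] by (intro front_next[OF assms(1,2)]) (auto simp: hatItw_iff)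
qed

definition col_vertex :: "nat \<Rightarrow> nat" where
  "col_vertex \<iota> = (if \<iota> < n then \<iota> else \<iota> - 1)"

lemma outer_column:
  assumes "\<iota> \<noteq> n" "\<iota> \<in> {1..<2*n}"
  shows "ctop \<iota> = 2 * \<xi> (col_vertex \<iota>)" "cstep \<iota> = 4" "col_vertex \<iota> \<in> {1..2*n-2}"
    and "clow \<iota> = 2 * \<xi> (2 * n - 1 - col_vertex \<iota>) - 4 * int n + 2"
proof -
  have "\<not> \<iota> < n \<Longrightarrow> 2 * n - 1 - (\<iota> - 1) = 2 * n - \<iota>" using assms by auto
  then show "clow \<iota> = 2 * \<xi> (2 * n - 1 - col_vertex \<iota>) - 4 * int n + 2"
    using assms(1) by (simp add: col_low_def col_vertex_def)
qed (use assms in \<open>auto simp: col_vertex_def col_top_def col_step_def\<close>)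

text \<open>Neighbouring columns interlace: the class of kappa contains r +
  \<open>rB n (fld \<kappa>)\<close> but not r. The work lies at the ends of the column, where
  heights changing by 1 along the path keep this value in range.\<close>

lemma front_outer_neighbour:
  assumes "Suc t \<le> ell" "pos (Suc t) = (\<iota>, r)" "\<iota> \<noteq> n"
    "\<kappa> = \<iota> + 1 \<or> \<iota> = \<kappa> + 1" "\<kappa> \<in> {1..<2*n}"
  shows "front t \<kappa> = r + rB n (fld \<kappa>)"
proof -
  have T: "\<iota> \<in> {1..<2*n}" "4 dvd ctop \<iota> - r" "clow \<iota> < r" "r \<le> ctop \<iota>"
    using pos_mem[of "Suc t"] assms by (auto simp: hatItw_iff col_step_def)
  show ?thesis
  proof (cases "\<kappa> = n")
    case True
    have r: "even r" using T(2) even_outer_top[OF assms(3)] by presburger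
    have i: "\<iota> = n - 1 \<or> \<iota> = n + 1" using True assms by auto
    have e: "2 * n - 1 - (n - 1) = n" "2 * n - (n + 1) = n - 1" using n_ge by auto
    obtain q where q: "ctop \<iota> - r = 4 * q" using T(2) by (elim dvdE)
    have "clow n < r + 1" "r + 1 \<le> ctop n + cstep n"
    proof -
      have v: "ctop \<iota> = 2 * \<xi> (n - 1) \<and> clow \<iota> = 2 * \<xi> n - 4 * int n + 2 \<or>
          ctop \<iota> = 2 * \<xi> n \<and> clow \<iota> = 2 * \<xi> (n - 1) - 4 * int n + 2"
        using i e n_ge by (auto simp: col_top_def col_low_def)
      have m: "\<xi> n = \<xi> (n - 1) + 1 \<or> \<xi> (n - 1) = \<xi> n + 1" using middle_height by linarith
      note cs = max_diff_one_cases[OF m] v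
      \<comment> \<open>Write M for the maximum. If the top of iota is 2M, its lower bound is only
        2M - 4n, too weak by 2; as r is in the class of the top mod 4, it improves to r >= 2M - 4n +
        4, that is q < n.\<close>
      have "q < int n \<or> 2 * max (\<xi> (n - 1)) (\<xi> n) - 4 * int n + 2 < r"
        using cs T(3,4) q by (elim disjE conjE) linarith+
      then have "2 * max (\<xi> (n - 1)) (\<xi> n) - 4 * int n + 2 < r" 
        using cs T(3,4) q by (elim disjE conjE) linarith+
      moreover have "r \<le> 2 * max (\<xi> (n - 1)) (\<xi> n)"
        using cs T(4) by (elim disjE conjE) linarith+
      ultimately show "clow n < r + 1" "r + 1 \<le> ctop n + cstep n"
        by (auto simp: col_low_def col_top_def col_step_def)
    qed
    moreover have "rB n (fld \<kappa>) = 1" using True by (simp add: rB_def fold_col_def)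
    ultimately show ?thesis
      using assms True r odd_middle_top by (intro front_next[OF assms(1,2)]) (auto simp: col_step_def)
  next
    case False
    define a b where "a = col_vertex \<iota>" and "b = col_vertex \<kappa>"
    have ab: "ctop \<iota> = 2 * \<xi> a" "ctop \<kappa> = 2 * \<xi> b"
      "clow \<iota> = 2 * \<xi> (2 * n - 1 - a) - 4 * int n + 2" "clow \<kappa> = 2 * \<xi> (2 * n - 1 - b) - 4 * int n + 2"
      "a \<in> {1..2*n-2}" "b \<in> {1..2*n-2}"
      using outer_column[OF assms(3) T(1)] outer_column[OF False assms(5)] by (simp_all add: a_def b_def)
    have adj: "a = b + 1 \<or> b = a + 1"
      using assms(3,4) False T(1) assms(5) unfolding a_def b_def col_vertex_def by auto
    have "\<bar>\<xi> b - \<xi> a\<bar> \<le> 1" "odd (\<xi> b - \<xi> a)"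
      using height_lipschitz[OF ab(5,6)] height_parity[OF ab(5,6)] adj by auto
    moreover have "\<bar>\<xi> (2 * n - 1 - b) - \<xi> (2 * n - 1 - a)\<bar> \<le> 1"
    proof -
      have "2 * n - 1 - a \<in> {1..2*n-2}" "2 * n - 1 - b \<in> {1..2*n-2}" using ab(5,6) by auto
      from height_lipschitz[OF this] show ?thesis using ab(5,6) adj by (auto simp: of_nat_diff)
    qed
    moreover have "4 dvd 2 * \<xi> b - (r + 2)" "\<not> 4 dvd 2 * \<xi> b - r"
      using calculation(2) T(2) ab(1) by presburger+
    moreover have "rB n (fld \<kappa>) = 2" using False assms by (auto simp: rB_def fold_col_def)
    moreover have s: "cstep \<kappa> = 4" using False by (simp add: col_step_def)
    moreover have "clow \<kappa> < r + 2"
      using T(3) calculation(3) ab(3,4) by linarith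
    moreover have "r + 2 \<le> ctop \<kappa> + cstep \<kappa>"
      using T(4) calculation(1) ab(1,2) s by linarith
    ultimately show ?thesis
      using front_next[OF assms(1,2,5), of "r + 2"] ab(2) by simp
  qed
qed

text \<open>Columns n - 1 and n + 1 occupy the two even classes mod 4, hence the offsets 1 and 3 in
  some order. Both fold to row n - 1 and are read after subtracting 2, so either order gives the two
  terms of the last row of C(z).\<close>

lemma front_middle_neighbours:
  assumes "Suc t \<le> ell" "pos (Suc t) = (n, r)"
  shows "(front t (n - 1) = r + 1 \<and> front t (n + 1) = r + 3) \<or>
    (front t (n - 1) = r + 3 \<and> front t (n + 1) = r + 1)"
proof -
  have T: "2 dvd ctop n - r" "clow n < r" "r \<le> ctop n"
    using pos_mem[of "Suc t"] assms by (auto simp: hatItw_iff col_step_def)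
  have r: "odd r" using T(1) odd_middle_top by presburger
  have e: "2 * n - 1 - (n - 1) = n" "2 * n - (n + 1) = n - 1" using n_ge by auto
  have v: "ctop (n - 1) = 2 * \<xi> (n - 1)" "ctop (n + 1) = 2 * \<xi> n"
    "clow (n - 1) = 2 * \<xi> n - 4 * int n + 2" "clow (n + 1) = 2 * \<xi> (n - 1) - 4 * int n + 2"
    "cstep (n - 1) = 4" "cstep (n + 1) = 4"
    using n_ge e by (auto simp: col_top_def col_low_def col_step_def)
  have o: "odd (\<xi> n - \<xi> (n - 1))" using middle_height by presburger
  have b: "2 * max (\<xi> (n - 1)) (\<xi> n) - 4 * int n + 1 < r" "r \<le> 2 * max (\<xi> (n - 1)) (\<xi> n) + 1"
    using T by (auto simp: col_low_def col_top_def split: if_splits)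
  have nx: "front t \<kappa> = r + c" if "\<kappa> = n - 1 \<or> \<kappa> = n + 1" "4 dvd ctop \<kappa> - (r + c)" "c = 1 \<or> c = 3" for \<kappa> c
  proof (rule front_next[OF assms])
    note c = that
    show "\<kappa> \<in> {1..<2*n}" using that n_ge by auto
    show "cstep \<kappa> dvd ctop \<kappa> - (r + c)" "r < r + c" "r + c - cstep \<kappa> \<le> r" using that v by auto
    have m: "\<xi> n = \<xi> (n - 1) + 1 \<or> \<xi> (n - 1) = \<xi> n + 1" using middle_height by linarith
    have w: "ctop \<kappa> = 2 * \<xi> (n - 1) \<and> clow \<kappa> = 2 * \<xi> n - 4 * int n + 2 \<or>
          ctop \<kappa> = 2 * \<xi> n \<and> clow \<kappa> = 2 * \<xi> (n - 1) - 4 * int n + 2" "cstep \<kappa> = 4"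
      using that v by auto
    obtain q where q: "ctop \<kappa> - (r + c) = 4 * q" using c(2) by (elim dvdE)
    note cs = max_diff_one_cases[OF m] w(1) c(3)
    have "- 2 < q" using cs q b by (elim disjE conjE) linarith+
    then show "r + c \<le> ctop \<kappa> + cstep \<kappa>" using q w(2) by linarith
    show "clow \<kappa> < r + c" using cs b by (elim disjE conjE) linarith+
    show "\<kappa> = n \<or> \<not> cstep \<kappa> dvd ctop \<kappa> - r" using that v r by (auto, presburger+)
  qed
  have "(4 dvd ctop (n - 1) - (r + 1) \<and> 4 dvd ctop (n + 1) - (r + 3)) \<or>
    (4 dvd ctop (n - 1) - (r + 3) \<and> 4 dvd ctop (n + 1) - (r + 1))"
    unfolding v using r o by presburger
  then show ?thesis using nx[of "n - 1" 1] nx[of "n + 1" 3] nx[of "n - 1" 3] nx[of "n + 1" 1] by auto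
qed


text \<open>Twice the quiver vertex of an outer column, with the middle column halfway between n - 1
  and n. In these coordinates the tops of the outer columns are 1-Lipschitz, and distances are the
  bounds of \<open>ctilde_vanish\<close>.\<close>

definition col_pos :: "nat \<Rightarrow> int" where
  "col_pos \<iota> = (if \<iota> < n then 2 * int \<iota> else if \<iota> = n then 2 * int n - 1 else 2 * int \<iota> - 2)"

section \<open>The initial values of the recursion\<close>

lemma top_gap:
  assumes "\<iota> \<in> {1..<2*n}" "\<kappa> \<in> {1..<2*n}"
  shows "ctop \<iota> + cstep \<iota> - ctop \<kappa> > - \<bar>col_pos \<iota> - col_pos \<kappa>\<bar>"
proof -
  define v where "v = col_vertex"
  have outer: "ctop \<iota> = 2 * \<xi> (v \<iota>)" "cstep \<iota> = 4" "col_pos \<iota> = 2 * int (v \<iota>)"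
    "v \<iota> \<in> {1..2*n-2}" if "\<iota> \<noteq> n" "\<iota> \<in> {1..<2*n}" for \<iota>
    using outer_column[OF that] that by (auto simp: v_def col_pos_def col_vertex_def of_nat_diff)
  have nn: "n - 1 \<in> {1..2*n-2}" "n \<in> {1..2*n-2}" "int (n - 1) = int n - 1" using n_ge by auto
  have near: "\<bar>\<xi> a - \<xi> (n - 1)\<bar> \<le> \<bar>int a - int n + 1\<bar>" "\<bar>\<xi> a - \<xi> n\<bar> \<le> \<bar>int a - int n\<bar>"
    if "a \<in> {1..2*n-2}" for a
    using height_lipschitz[OF nn(1) that] height_lipschitz[OF nn(2) that] unfolding nn(3) by (simp_all add: algebra_simps)
  have inner: "ctop n + cstep n \<ge> 2 * \<xi> n + 1" "ctop n + cstep n \<ge> 2 * \<xi> (n - 1) + 1"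
     "ctop n \<le> 2 * \<xi> n + 3" "ctop n \<le> 2 * \<xi> (n - 1) + 3"
    "cstep n = 2" "col_pos n = 2 * int n - 1"
    using middle_height by (auto simp: col_top_def col_step_def col_pos_def)
  consider "\<iota> = n" "\<kappa> = n" | "\<iota> = n" "\<kappa> \<noteq> n" | "\<iota> \<noteq> n" "\<kappa> = n" | "\<iota> \<noteq> n" "\<kappa> \<noteq> n" by blast
  then show ?thesis
  proof cases
    case 1
    then show ?thesis by (simp add: inner)
  next
    case 2
    then show ?thesis using near[OF outer(4)[OF 2(2) assms(2)]] outer(1,3)[OF 2(2) assms(2)] inner
      unfolding 2(1) by linarith
  next
    case 3
    then show ?thesis using near[OF outer(4)[OF 3(1) assms(1)]] outer(1-3)[OF 3(1) assms(1)] inner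
      unfolding 3(2) by linarith
  next
    case 4
    then show ?thesis using height_lipschitz[OF outer(4)[OF 4(1) assms(1)] outer(4)[OF 4(2) assms(2)]]
        outer[OF 4(1) assms(1)] outer[OF 4(2) assms(2)]
      by linarith
  qed
qed

text \<open>A column that is still untouched is controlled by the comparison of tops; in any other
  column the front is not below the current height.\<close>

lemma front_gap:
  assumes "k \<in> {1..ell}" "\<iota> \<in> {1..<2*n}" "\<iota> \<noteq> w k"
  shows "front k \<iota> - ht k > - \<bar>col_pos \<iota> - col_pos (w k)\<bar>"
proof -
  have T: "(w k, ht k) \<in> T" using pos_mem[OF assms(1)] by simp
  from front_cases[of k \<iota>] assms(1)
  consider "front k \<iota> = ctop \<iota> + cstep \<iota>" | s where "s \<in> {1..k}" "pos s = (\<iota>, front k \<iota>)" by force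
  then show ?thesis
  proof cases
    case 1
    moreover have "ht k \<le> ctop (w k)" using T unfolding hatItw_iff by blast
    ultimately show ?thesis using top_gap[OF assms(2) letters[OF assms(1)]] by linarith
  next
    case 2
    then have "ht k \<le> front k \<iota>" using pos_sorted[of s k] assms by (cases "s = k") auto
    moreover have "col_pos \<iota> \<noteq> col_pos (w k)"
      using assms(2,3) letters[OF assms(1)] by (auto simp: col_pos_def split: if_splits)
    ultimately show ?thesis by linarith
  qed
qed

lemma front_lattice:
  assumes "t \<le> ell"
  shows "cstep \<iota> dvd ctop \<iota> - front t \<iota>"
proof -
  from front_cases[OF assms, of \<iota>]
  consider "front t \<iota> = ctop \<iota> + cstep \<iota>" | s where "s \<in> {1..t}" "pos s = (\<iota>, front t \<iota>)" by force
  then show ?thesis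
  proof cases
    case 2
    then show ?thesis using pos_mem[of s] assms by (auto simp: hatItw_iff)
  qed simp
qed

text \<open>The candidate for -(beta_k, w_(<=t) varpi_iota).\<close>

definition front_val :: "nat \<Rightarrow> nat \<Rightarrow> nat \<Rightarrow> int" where
  "front_val k t \<iota> = ctilde n (fld \<iota>) (fld (w k)) (front t \<iota> - ht k - rB n (fld \<iota>))"

text \<open>The residues mod 4 of two opposite columns force the parity that is possible only
  through the loop, and c is the resulting distance across the middle. Either sign of x - y is
  allowed, so that either column may be the one being read.\<close>

lemma ctilde_opposite:
  assumes "\<iota> < n" "\<kappa> = 2 * n - i" "i < n" "1 \<le> i" "1 \<le> \<iota>"
    and "4 dvd ctop \<iota> - x" "4 dvd ctop \<kappa> - y" "\<bar>col_pos \<iota> - col_pos \<kappa>\<bar> = c" 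
    and "m = x - y \<or> m = y - x" "m > - c"
  shows "ctilde n \<iota> i (m - 2) = 0" "ctilde n i \<iota> (m - 2) = 0"
proof -
  have k: "\<not> \<kappa> < n" "\<kappa> \<noteq> n" "\<kappa> - 1 = 2 * n - 1 - i" using assms by auto
  have "even (\<xi> (\<kappa> - 1) - \<xi> \<iota>) \<longleftrightarrow> even (int (\<kappa> - 1) - int \<iota>)"
    by (rule height_parity) (use assms in auto)
  moreover have "int (\<kappa> - 1) = 2 * int n - 1 - int i" using k assms by (simp add: of_nat_diff)
  ultimately have par: "even (\<xi> (\<kappa> - 1) - \<xi> \<iota> - (int i + int \<iota> + 1))" by simp presburger
  obtain p q e where e: "ctop \<iota> - x = 4 * p" "ctop \<kappa> - y = 4 * q"
    "\<xi> (\<kappa> - 1) - \<xi> \<iota> - (int i + int \<iota> + 1) = 2 * e"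
    using assms(6,7) par by (elim dvdE) blast
  have t: "ctop \<iota> = 2 * \<xi> \<iota>" "ctop \<kappa> = 2 * \<xi> (\<kappa> - 1)" using assms(1) k by (auto simp: col_top_def)
  have c: "c = 2 * (2 * int n - 1 - int i - int \<iota>)"
    using assms(1,3,8) k by (auto simp: col_pos_def assms(2) of_nat_diff)
  have "2 * (int i + int \<iota> + 1) - (x - y) = 4 * (p - q + \<xi> (\<kappa> - 1) - \<xi> \<iota> - e)"
    "2 * (int i + int \<iota> + 1) - (y - x) = 4 * (q - p - e)"
    using e unfolding t by (simp_all add: algebra_simps)
  then have "(2 * (int i + int \<iota> + 1) - m) mod 4 = 0" using assms(9) by auto
  then show "ctilde n \<iota> i (m - 2) = 0" "ctilde n i \<iota> (m - 2) = 0"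
    using ctilde_vanish(2)[of n \<iota> i m] ctilde_vanish(2)[of n i \<iota> m] n_ge assms c
    by (auto simp: algebra_simps)
qed

text \<open>On the column of k this is the leading coefficient of a diagonal entry. On any other
  column the gap of the front puts the degree inside the range of vanishing, with one case for each
  relative position of the two columns and the middle.\<close>

lemma front_val_start:
  assumes "k \<in> {1..ell}" "\<iota> \<in> {1..<2*n}"
  shows "front_val k k \<iota> = (if \<iota> = w k then 1 else 0)"
proof (cases "\<iota> = w k")
  case True
  have "front k (w k) = ht k" using assms by (cases k) auto
  then show ?thesis using True ctilde_diag_leading[OF n_ge fold_col_range[OF letters[OF assms(1)]]]
    by (simp add: front_val_def)
next
  case False
  define m where "m = front k \<iota> - ht k"
  define j i where "j = fld \<iota>" and "i = fld (w k)"
  have m: "m > - \<bar>col_pos \<iota> - col_pos (w k)\<bar>" using front_gap[OF assms False] by (simp add: m_def)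
  have wk: "w k \<in> {1..<2*n}" using letters assms by blast
  have ji: "j \<in> {1..n}" "i \<in> {1..n}" unfolding j_def i_def using fold_col_range assms wk by blast+
  have lat: "cstep \<iota> dvd ctop \<iota> - front k \<iota>" "cstep (w k) dvd ctop (w k) - ht k"
    using front_lattice[of k \<iota>] assms(1) pos_mem[OF assms(1)] hatItw_iff[of "w k" "ht k"] by auto
  have "ctilde n j i (m - rB n j) = 0"
  proof -
    consider "\<iota> = n" | "\<iota> \<noteq> n" "w k = n" | "\<iota> < n" "w k < n" | "\<iota> > n" "w k > n"
      | "\<iota> < n" "w k > n" | "\<iota> > n" "w k < n"
      by linarith
    then show ?thesis
    proof cases
      case 1
      then have "i < n" "j = n" using False ji wk by (auto simp: i_def j_def fold_col_def)
      moreover have "\<bar>col_pos \<iota> - col_pos (w k)\<bar> = 2 * (int n - int i) - 1"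
        using 1 False wk by (auto simp: col_pos_def i_def fold_col_def of_nat_diff)
      ultimately show ?thesis using ctilde_vanish(3)[of n 1 i m] ji m n_ge by (simp add: rB_def)
    next
      case 2
      then have "j < n" "i = n" using ji assms by (auto simp: i_def j_def fold_col_def)
      moreover have "\<bar>col_pos \<iota> - col_pos (w k)\<bar> = 2 * (int n - int j) - 1"
        using 2 assms by (auto simp: col_pos_def j_def fold_col_def of_nat_diff)
      ultimately show ?thesis using ctilde_vanish(4)[of n j 1 m] ji m n_ge by (simp add: rB_def)
    next
      case 3
      then have "j < n" "i < n" "\<bar>col_pos \<iota> - col_pos (w k)\<bar> = 2 * \<bar>int i - int j\<bar>"
        by (auto simp: i_def j_def fold_col_def col_pos_def abs_if)
      then show ?thesis using ctilde_vanish(1)[of n j i m] ji m n_ge by (simp add: rB_def)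
    next
      case 4
      then have "j < n" "i < n" "\<bar>col_pos \<iota> - col_pos (w k)\<bar> = 2 * \<bar>int i - int j\<bar>"
        using assms(2) wk by (auto simp: i_def j_def fold_col_def col_pos_def of_nat_diff abs_if)
      then show ?thesis using ctilde_vanish(1)[of n j i m] ji m n_ge by (simp add: rB_def)
    next
      case 5
      then have "j < n" "i < n" "\<iota> = j" "w k = 2 * n - i"
        using assms(2) wk by (auto simp: i_def j_def fold_col_def)
      then show ?thesis
        using ctilde_opposite(1)[of \<iota> "w k" i "front k \<iota>" "ht k" _ m] ji m lat 5
        by (simp add: rB_def m_def col_step_def)
    next
      case 6
      then have "j < n" "i < n" "w k = i" "\<iota> = 2 * n - j"
        using assms(2) wk by (auto simp: i_def j_def fold_col_def)
      then show ?thesis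
        using ctilde_opposite(2)[of "w k" \<iota> j "ht k" "front k \<iota>" _ m] ji m lat 6
        by (simp add: rB_def m_def col_step_def abs_minus_commute)
    qed
  qed
  then show ?thesis using False by (simp add: front_val_def m_def j_def i_def)
qed

text \<open>Placing a vertex lowers the front of its column by 2 r_j, so the old and the new value
  sit in degrees m + r_j and m - r_j. They form the diagonal part of row j of C(z), and the fronts
  of the neighbours supply the rest of the row.\<close>

lemma front_val_Suc:
  assumes "k \<in> {1..t}" "Suc t \<le> ell"
  shows "front_val k (Suc t) \<iota> =
    (if \<iota> = w (Suc t) then front_val k t (\<iota> - 1) + front_val k t (\<iota> + 1) - front_val k t \<iota>
     else front_val k t \<iota>)"
proof (cases "\<iota> = w (Suc t)")
  case True
  define r where "r = ht (Suc t)"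
  define m where "m = r - ht k"
  define j i where "j = fld \<iota>" and "i = fld (w k)"
  have pS: "pos (Suc t) = (\<iota>, r)" using True by (simp add: r_def)
  have ki: "k \<in> {1..ell}" "Suc t \<in> {1..ell}" using assms by auto
  have \<iota>: "\<iota> \<in> {1..<2*n}" using letters[OF ki(2)] True by simp
  have i: "i \<in> {1..n}" unfolding i_def using letters[OF ki(1)] fold_col_range by blast
  have j: "j \<in> {1..n}" unfolding j_def using \<iota> fold_col_range by blast
  \<comment> \<open>The right-hand side 1 of the matrix equation would appear only if the vertices k
    and t + 1 coincided.\<close>
  have diag: "\<not> (j = i \<and> m = 0)"
  proof
    assume *: "j = i \<and> m = 0"
    have "(\<iota>, r) \<in> T" "(w k, r) \<in> T"
      using pos_mem[OF ki(1)] pos_mem[OF ki(2)] pS * by (auto simp: m_def)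
    then have "\<iota> = w k" using folded_position_inj * by (auto simp: i_def j_def)
    then have "pos k = pos (Suc t)" using pS * by (auto simp: m_def prod_eq_iff)
    then show False using pos_inj[OF ki] assms(1) by auto
  qed
  have new: "front_val k (Suc t) \<iota> = ctilde n j i (m - rB n j)"
    using True by (simp add: front_val_def j_def i_def m_def r_def)
  have old: "front_val k t \<iota> = ctilde n j i (m + rB n j)"
    using front_same_column[OF assms(2) pS] col_step_rB[OF \<iota>]
    by (simp add: front_val_def j_def i_def m_def algebra_simps)
  have "front_val k t (\<iota> - 1) + front_val k t (\<iota> + 1) = front_val k (Suc t) \<iota> + front_val k t \<iota>"
  proof (cases "\<iota> = n")
    case False
    \<comment> \<open>The ends kappa = 0 and kappa = 2n are included: both fold to 0, where
      \<open>ctilde\<close> vanishes, in accordance with varpi_0 = varpi_2n = 0.\<close>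
    have nb: "front_val k t \<kappa> = ctilde n (fld \<kappa>) i m" if "\<kappa> = \<iota> + 1 \<or> \<iota> = \<kappa> + 1" for \<kappa>
    proof (cases "\<kappa> \<in> {1..<2*n}")
      case True
      then show ?thesis using front_outer_neighbour[OF assms(2) pS False that True]
        by (simp add: front_val_def i_def m_def)
    next
      case False
      then have "fld \<kappa> = 0" using that \<iota> by (auto simp: fold_col_def)
      then show ?thesis by (simp add: front_val_def ctilde_eq[OF n_ge] ctilde_sol_outside)
    qed
    have "1 \<le> j" "j < n" using False \<iota> by (auto simp: j_def fold_col_def)
    moreover have "fld (\<iota> - 1) = j - 1 \<and> fld (\<iota> + 1) = j + 1 \<or> fld (\<iota> - 1) = j + 1 \<and> fld (\<iota> + 1) = j - 1"
      using False \<iota> by (auto simp: j_def fold_col_def)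
    ultimately show ?thesis
      using ctilde_row[OF n_ge, of j i m] i diag nb[of "\<iota> - 1"] nb[of "\<iota> + 1"] \<iota> new old
      by (auto simp: rB_def)
  next
    case n: True
    have jn: "j = n" using n by (simp add: j_def fold_col_def)
    have f: "fld (n - 1) = n - 1" "fld (n + 1) = n - 1" "rB n (n - 1) = 2"
      using n_ge by (auto simp: fold_col_def rB_def)
    have "front_val k t (n - 1) + front_val k t (n + 1) = ctilde n (n - 1) i (m - 1) + ctilde n (n - 1) i (m + 1)"
      using front_middle_neighbours[OF assms(2), of r] pS n
      by (auto simp: front_val_def f[simplified] f i_def m_def algebra_simps)
    then show ?thesis using ctilde_last_row[OF n_ge i, of m] diag new old jn n
      by (auto simp: rB_def)
  qed
  then show ?thesis using True by simp
qed (simp add: front_val_def)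

lemma front_val_end: "front_val k t 0 = 0" "front_val k t (2 * n) = 0"
  using n_ge by (simp_all add: front_val_def fold_col_def ctilde_eq ctilde_sol_outside)

text \<open>Same recursion, same zero boundary values at 0 and 2n; the sign comes from t = k, where
  the root has just been reflected.\<close>

lemma root_weight_front_val:
  assumes "1 \<le> k" "k \<le> t" "t \<le> ell" "\<iota> \<le> 2 * n"
  shows "root_weight n w k t \<iota> = - of_int (front_val k t \<iota>)"
  using assms(2-4)
proof (induction t arbitrary: \<iota> rule: dec_induct)
  case base
  have sl: "simple_letters n w k" using simple_letters_mono[OF simple_word] base by blast
  have "\<iota> = 0 \<or> \<iota> = 2 * n \<or> \<iota> \<in> {1..<2*n}" using base by auto
  then show ?case
    using root_weight_end[OF sl, of k] front_val_end root_weight_start(2)[OF sl assms(1), of \<iota>]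
      front_val_start[of k \<iota>] base assms(1) by auto
next
  case (step t)
  have sl: "simple_letters n w (Suc t)" using simple_letters_mono[OF simple_word] step by blast
  have wt: "w (Suc t) \<in> {1..<2*n}" using letters[of "Suc t"] step by simp
  show ?case
    unfolding root_weight_Suc[OF sl]
    using step.IH[of \<iota>] step.IH[of "\<iota> - 1"] step.IH[of "\<iota> + 1"] wt step.prems step.hyps
      front_val_Suc[of k t \<iota>] assms(1)
    by (auto simp del: front.simps)
qed

lemma fold_w_pos: "ovl n (pos s) = (fld (w s), ht s)"
  using ovl_eq[of n "w s" "ht s"] by simp

text \<open>The pairing is the jump of \<open>front_val\<close> at step l, which is one half of
  gamma, in degree m <= 0. The other half, in degree -m, vanishes because the two vertices are
  distinct.\<close>

lemma gammaB_root_pairing: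
  assumes "1 \<le> k" "k < l" "l \<le> ell"
  shows "ipA n (word_root n w k) (word_root n w l) = of_int (gammaB n (ovl n (pos k)) (ovl n (pos l)))"
proof -
  obtain t where l: "l = Suc t" using assms by (cases l) auto
  define i j m where "i = fld (w k)" and "j = fld (w l)" and "m = ht l - ht k"
  have kl: "k \<in> {1..ell}" "l \<in> {1..ell}" using assms by auto
  have wl: "w l \<in> {1..<2*n}" using letters kl by blast
  have ij: "i \<in> {1..n}" "j \<in> {1..n}" unfolding i_def j_def using letters kl fold_col_range by blast+
  have m: "m \<le> 0" using pos_sorted assms by (simp add: m_def)
  have diag: "\<not> (j = i \<and> m = 0)"
  proof
    assume *: "j = i \<and> m = 0"
    have "pos l = (w l, ht l)" "pos k = (w k, ht l)" using * by (auto simp: m_def prod_eq_iff)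
    then have "(w l, ht l) \<in> T" "(w k, ht l) \<in> T"
      using pos_mem[OF kl(1)] pos_mem[OF kl(2)] by metis+
    from folded_position_inj[OF this] have "w l = w k" using * by (simp add: i_def j_def)
    then have "pos k = pos l" using * by (auto simp: m_def prod_eq_iff)
    then show False using pos_inj[OF kl] assms by auto
  qed
  have "front_val k l (w l) = ctilde n j i (m - rB n j)"
    by (simp add: front_val_def l j_def i_def m_def)
  moreover have "front_val k (l - 1) (w l) = ctilde n j i (m + rB n j)"
    using front_same_column[of t "w l" "ht l"] assms col_step_rB[OF wl]
    by (simp add: front_val_def l j_def i_def m_def algebra_simps)
  ultimately have "front_val k l (w l) - front_val k (l - 1) (w l) = ctilde_diff n j i m"
    by (simp add: ctilde_diff_def)
  moreover have "ctilde_diff n j i (- m) = 0"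
    using ctilde_diff_pos[OF n_ge ij, of "- m"] m diag by (cases "m = 0") auto
  ultimately have "gammaB n (ovl n (pos k)) (ovl n (pos l)) = front_val k l (w l) - front_val k (l - 1) (w l)"
    unfolding fold_w_pos gammaB_conv by (simp add: m_def i_def j_def)
  then show ?thesis
    unfolding ipA_word_root using root_weight_front_val[of k l "w l"] root_weight_front_val[of k "l - 1" "w l"]
      assms wl by simp
qed

lemma signed_form_gammaB:
  assumes "1 \<le> k" "k \<le> ell" "1 \<le> l" "l \<le> ell"
  shows "signed_form n w k l = of_int (gammaB n (ovl n (pos k)) (ovl n (pos l)))"
proof (cases k l rule: linorder_cases)
  case less
  then show ?thesis using gammaB_root_pairing[of k l] assms by (simp add: signed_form_def)
next
  case equal
  then show ?thesis by (simp add: signed_form_def gammaB_self)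
next
  case greater
  have "gammaB n (ovl n (pos k)) (ovl n (pos l)) = - gammaB n (ovl n (pos l)) (ovl n (pos k))"
    by (rule gammaB_antisym[OF n_ge]) (use letters fold_col_range assms in \<open>simp_all add: fold_w_pos\<close>)
  then show ?thesis using gammaB_root_pairing[of l k] greater assms
    by (simp add: signed_form_def ipA_commute[of n "word_root n w k"])
qed

lemma LamM_gammaB:
  assumes "s \<in> {1..ell}" "t \<in> {1..ell}"
  shows "LamM n w s t = - (\<Sum>k\<in>{k\<in>{1..s}. w k = w s}. \<Sum>l\<in>{l\<in>{1..t}. w l = w t}.
     gammaB n (ovl n (pos k)) (ovl n (pos l)))"
  by (rule LamM_eq[where m = ell]) (use assms simple_word signed_form_gammaB in auto)

end

section \<open>Quantum tori\<close>

lemma NY_superset: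
  assumes "finite S" "Poly_Mapping.keys a \<subseteq> S" "Poly_Mapping.keys b \<subseteq> S"
  shows "NY n a b = (\<Sum>x\<in>S. \<Sum>y\<in>S. Poly_Mapping.lookup a x * Poly_Mapping.lookup b y * gammaB n x y)"
proof -
  have "NY n a b = (\<Sum>x\<in>Poly_Mapping.keys a. \<Sum>y\<in>S. Poly_Mapping.lookup a x * Poly_Mapping.lookup b y * gammaB n x y)"
    unfolding NY_def using assms
    by (intro sum.cong refl sum.mono_neutral_left) (auto simp: in_keys_iff)
  also have "\<dots> = (\<Sum>x\<in>S. \<Sum>y\<in>S. Poly_Mapping.lookup a x * Poly_Mapping.lookup b y * gammaB n x y)"
    using assms by (intro sum.mono_neutral_left) (auto simp: in_keys_iff)
  finally show ?thesis .
qed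

lemma NY_zero: "NY n 0 b = 0" "NY n a 0 = 0"
  by (simp_all add: NY_def)

lemma qmult_qmon:
  "qmult N (qmon a k) (qmon b l) = qmon (a + b) (k + l + N a b)"
proof -
  have s: "{p. qmon a k p \<noteq> 0} = {(a, k)}" for a :: 'a and k by (auto simp: qmon_def)
  show ?thesis unfolding qmult_def s by (auto simp: qmon_def fun_eq_iff)
qed

lemma qmon_support: "{p. qmon a k p \<noteq> 0} = {(a, k)}"
  by (auto simp: qmon_def)

lemma qmult_nonzeroE:
  assumes "qmult N f g x \<noteq> 0"
  obtains p q where "f p \<noteq> 0" "g q \<noteq> 0" "x = (fst p + fst q, snd p + snd q + N (fst p) (fst q))"
proof -
  obtain c m where x: "x = (c, m)" by (cases x)
  from assms obtain p where p: "f p \<noteq> 0"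
    "(\<Sum>q\<in>{q. g q \<noteq> 0}. if fst p + fst q = c \<and> snd p + snd q + N (fst p) (fst q) = m
        then f p * g q else 0) \<noteq> 0"
    unfolding qmult_def x by (auto elim: sum.not_neutral_contains_not_neutral)
  from p(2) obtain q where "g q \<noteq> 0" "fst p + fst q = c \<and> snd p + snd q + N (fst p) (fst q) = m"
    by (elim sum.not_neutral_contains_not_neutral) (auto split: if_splits)
  then show thesis using p(1) that x by auto
qed

lemma qfin_qmult:
  assumes "qfin f" "qfin g"
  shows "qfin (qmult N f g)"
proof -
  have "{x. qmult N f g x \<noteq> 0} \<subseteq>
    (\<lambda>(p, q). (fst p + fst q, snd p + snd q + N (fst p) (fst q))) ` ({p. f p \<noteq> 0} \<times> {q. g q \<noteq> 0})"
    by (auto elim!: qmult_nonzeroE simp: image_iff)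
  moreover have "finite ({p. f p \<noteq> 0} \<times> {q. g q \<noteq> 0})"
    using assms by (simp add: qfin_def)
  ultimately show ?thesis unfolding qfin_def by (meson finite_imageI finite_subset)
qed

lemma qfin_qadd: "qfin f \<Longrightarrow> qfin g \<Longrightarrow> qfin (qadd f g)"
  unfolding qfin_def qadd_def
  by (rule finite_subset[of _ "{x. f x \<noteq> 0} \<union> {x. g x \<noteq> 0}"]) auto

lemma qfin_qmon: "qfin (qmon a k)"
  by (simp add: qfin_def qmon_support)

section \<open>The subalgebra described by supports of exponents\<close>

definition qsupported :: "'g set \<Rightarrow> 'g qtor set" where
  "qsupported A = {f. qfin f \<and> (\<forall>a k. f (a, k) \<noteq> 0 \<longrightarrow> a \<in> A)}"

lemma qmon_mem: "a \<in> A \<Longrightarrow> qmon a k \<in> qsupported A"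
  unfolding qsupported_def using qfin_qmon[of a k] by (simp add: qmon_def split: if_splits)

lemma Ysubalg_subset: "Ysubalg n S \<subseteq> qsupported {b. Poly_Mapping.keys b \<subseteq> S}"
proof
  fix f assume "f \<in> Ysubalg n S"
  then show "f \<in> qsupported {b. Poly_Mapping.keys b \<subseteq> S}"
  proof (induction rule: Ysubalg.induct)
    case (add f g)
    have "Poly_Mapping.keys a \<subseteq> S" if "qadd f g (a, k) \<noteq> 0" for a k
    proof -
      have "f (a, k) \<noteq> 0 \<or> g (a, k) \<noteq> 0" using that by (auto simp: qadd_def)
      then show ?thesis using add.IH unfolding qsupported_def by blast
    qed
    then show ?case using add.IH qfin_qadd unfolding qsupported_def by blast
  next
    case (neg f)
    then show ?case by (simp add: qsupported_def qfin_def qneg_def)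
  next
    case (mult f g)
    have "Poly_Mapping.keys a \<subseteq> S" if "qmult (NY n) f g (a, k) \<noteq> 0" for a k
      using that
    proof (rule qmult_nonzeroE)
      fix p q assume pq: "f p \<noteq> 0" "g q \<noteq> 0"
        "(a, k) = (fst p + fst q, snd p + snd q + NY n (fst p) (fst q))"
      then have "Poly_Mapping.keys (fst p) \<subseteq> S" "Poly_Mapping.keys (fst q) \<subseteq> S"
        using mult.IH by (auto simp: qsupported_def) (metis prod.collapse in_mono)+
      then show ?thesis using keys_add[of "fst p" "fst q"] pq(3) by auto
    qed
    then show ?case using mult.IH qfin_qmult unfolding qsupported_def by blast
  qed (auto simp: Ygen_def Ygen_inv_def intro!: qmon_mem)
qed

lemma Ysubalg_qmon_add:
  assumes "\<And>k. qmon a k \<in> Ysubalg n S" "\<And>k. qmon b k \<in> Ysubalg n S"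
  shows "qmon (a + b) k \<in> Ysubalg n S"
  using Ysubalg.mult[OF assms(1)[of "k - NY n a b"] assms(2)[of 0]] by (simp add: qmult_qmon)

lemma Ysubalg_qmon_scale:
  assumes "qmon a k \<in> Ysubalg n S"
  shows "qmon a l \<in> Ysubalg n S"
  using Ysubalg.mult[OF Ysubalg.scal[of "l - k"] assms] by (simp add: qmult_qmon NY_zero)

lemma Ysubalg_qmon_single:
  assumes "x \<in> S"
  shows "qmon (Poly_Mapping.single x c) k \<in> Ysubalg n S"
proof -
  have one: "qmon (Poly_Mapping.single x 1) k \<in> Ysubalg n S"
    "qmon (Poly_Mapping.single x (- 1)) k \<in> Ysubalg n S" for k
    using Ysubalg_qmon_scale Ysubalg.gen[OF assms, of n] Ysubalg.geninv[OF assms, of n]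
    unfolding Ygen_def Ygen_inv_def by blast+
  have "\<forall>k. qmon (Poly_Mapping.single x c) k \<in> Ysubalg n S"
  proof (induction c rule: int_induct[of _ 0])
    case base
    then show ?case by (simp add: Ysubalg.scal)
  next
    case (step1 c)
    then show ?case using Ysubalg_qmon_add[of "Poly_Mapping.single x c" n S "Poly_Mapping.single x 1"] one
      by (simp add: single_add)
  next
    case (step2 c)
    then show ?case using Ysubalg_qmon_add[of "Poly_Mapping.single x c" n S "Poly_Mapping.single x (- 1)"] one
      by (simp flip: single_add)
  qed
  then show ?thesis by blast
qed

lemma sum_single_lookup:
  assumes "finite S" "Poly_Mapping.keys b \<subseteq> S"
  shows "(\<Sum>x\<in>S. Poly_Mapping.single x (Poly_Mapping.lookup b x)) = b"
proof (rule poly_mapping_eqI)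
  fix y
  have "Poly_Mapping.lookup (\<Sum>x\<in>S. Poly_Mapping.single x (Poly_Mapping.lookup b x)) y
    = (\<Sum>x\<in>S. if x = y then Poly_Mapping.lookup b x else 0)"
    by (simp add: lookup_sum lookup_single when_def)
  also have "\<dots> = Poly_Mapping.lookup b y"
    using assms by (auto simp: in_keys_iff)
  finally show "Poly_Mapping.lookup (\<Sum>x\<in>S. Poly_Mapping.single x (Poly_Mapping.lookup b x)) y
    = Poly_Mapping.lookup b y" .
qed

lemma Ysubalg_qmon:
  assumes "Poly_Mapping.keys b \<subseteq> S"
  shows "qmon b k \<in> Ysubalg n S"
proof -
  have "\<forall>k. qmon (\<Sum>x\<in>X. Poly_Mapping.single x (Poly_Mapping.lookup b x)) k \<in> Ysubalg n S"
    if "finite X" "X \<subseteq> S" for X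
    using that
  proof (induction X rule: finite_induct)
    case (insert x X)
    then show ?case by (auto intro!: Ysubalg_qmon_add Ysubalg_qmon_single)
  qed (simp add: Ysubalg.scal)
  from this[OF finite_keys assms] show ?thesis
    using sum_single_lookup[of "Poly_Mapping.keys b" b] by simp
qed

text \<open>Integer multiples are not among the closure rules and have to be built from sums and
  negation.\<close>

lemma Ysubalg_smult:
  fixes c :: int
  assumes "f \<in> Ysubalg n S"
  shows "(\<lambda>x. c * f x) \<in> Ysubalg n S"
proof (induction c rule: int_induct[of _ 0])
  case base
  have "qadd f (qneg f) = (\<lambda>x. 0 * f x)" by (simp add: qadd_def qneg_def)
  then show ?case using Ysubalg.add[OF assms Ysubalg.neg[OF assms]] by simp
next
  case (step1 c)
  then show ?case using Ysubalg.add[OF step1(2) assms] by (simp add: qadd_def algebra_simps)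
next
  case (step2 c)
  then show ?case using Ysubalg.add[OF step2(2) Ysubalg.neg[OF assms]]
    by (simp add: qadd_def qneg_def algebra_simps)
qed

text \<open>Multiplying monomials changes the power of t only, and all powers of t are available, so
  exponents alone decide membership. This is the form in which the image of the isomorphism is
  identified.\<close>

lemma Ysubalg_eq: "Ysubalg n S = qsupported {b. Poly_Mapping.keys b \<subseteq> S}"
proof
  show "qsupported {b. Poly_Mapping.keys b \<subseteq> S} \<subseteq> Ysubalg n S"
  proof
    fix f :: "yexp qtor"
    assume f: "f \<in> qsupported {b. Poly_Mapping.keys b \<subseteq> S}"
    define P where "P = {p. f p \<noteq> 0}"
    have "(\<lambda>x. if x \<in> X then f x else 0) \<in> Ysubalg n S" if "finite X" "X \<subseteq> P" for X
      using that
    proof (induction X rule: finite_induct)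
      case empty
      then show ?case using Ysubalg_smult[OF Ysubalg.scal[of 0 n S], of 0] by simp
    next
      case (insert p X)
      obtain b k where p: "p = (b, k)" by (cases p)
      have "Poly_Mapping.keys b \<subseteq> S" using insert.prems f p by (auto simp: P_def qsupported_def)
      from Ysubalg_smult[OF Ysubalg_qmon[OF this, of k], of "f p"]
      have "qadd (\<lambda>x. f p * qmon b k x) (\<lambda>x. if x \<in> X then f x else 0) \<in> Ysubalg n S"
        using insert by (intro Ysubalg.add) auto
      also have "qadd (\<lambda>x. f p * qmon b k x) (\<lambda>x. if x \<in> X then f x else 0)
          = (\<lambda>x. if x \<in> insert p X then f x else 0)"
        using insert.hyps by (auto simp: qadd_def qmon_def p fun_eq_iff)
      finally show ?case .
    qed
    note part = this
    have eq: "(\<lambda>x. if x \<in> P then f x else 0) = f" by (auto simp: P_def)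
    have "finite P" using f by (simp add: P_def qsupported_def qfin_def)
    from part[OF this order_refl] show "f \<in> Ysubalg n S" unfolding eq .
  qed
qed (rule Ysubalg_subset)

section \<open>Bar-invariant monomials\<close>

lemma Yprod_qmon:
  "\<exists>e. Yprod n xs = qmon (\<Sum>x\<leftarrow>xs. Poly_Mapping.single x 1) e"
proof (induction xs)
  case (Cons x xs)
  then obtain e where "Yprod n xs = qmon (\<Sum>x\<leftarrow>xs. Poly_Mapping.single x 1) e" by blast
  moreover have "Yprod n (x # xs) = qmult (NY n) (Ygen x) (Yprod n xs)" by (simp add: Yprod_def)
  ultimately show ?case by (auto simp: Ygen_def qmult_qmon)
qed (auto simp: Yprod_def)

lemma qmon_eq_iff: "qmon a k = qmon b l \<longleftrightarrow> a = b \<and> k = l"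
proof
  assume "qmon a k = qmon b l"
  then have "{p. qmon a k p \<noteq> 0} = {p. qmon b l p \<noteq> 0}" by simp
  then show "a = b \<and> k = l" by (simp add: qmon_support)
qed simp

lemma qbar_qmon: "qbar (qmon a k) = qmon a (- k)"
  by (auto simp: qbar_def qmon_def fun_eq_iff)

text \<open>A product of generators is some t^(e/2) X^a, and bar negates the power of t; hence the
  scalar t^(-e/2) gives the only invariant multiple.\<close>

lemma underline_eq: "underline n xs = qmon (\<Sum>x\<leftarrow>xs. Poly_Mapping.single x 1) 0"
proof -
  obtain e where e: "Yprod n xs = qmon (\<Sum>x\<leftarrow>xs. Poly_Mapping.single x 1) e"
    using Yprod_qmon by blast
  show ?thesis unfolding underline_def e
    by (rule the_equality)
      (auto simp: qmult_qmon NY_zero qbar_qmon qmon_eq_iff intro: exI[of _ "- e"])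
qed

text \<open>Pushforward along an exponent map injective on \<open>A\<close>, combined with inversion of the quantum
  parameter.\<close>
definition qtransport :: "('g \<Rightarrow> 'h) \<Rightarrow> 'g set \<Rightarrow> 'g qtor \<Rightarrow> 'h qtor" where
  "qtransport L A f = (\<lambda>(b, k). if b \<in> L ` A then f (inv_into A L b, - k) else 0)"

lemma qtransport_apply:
  "inj_on L A \<Longrightarrow> a \<in> A \<Longrightarrow> qtransport L A f (L a, k) = f (a, - k)"
  by (simp add: qtransport_def)

lemma qtransport_qadd: "qtransport L A (qadd f g) = qadd (qtransport L A f) (qtransport L A g)"
  by (auto simp: qtransport_def qadd_def fun_eq_iff)

lemma qtransport_qbar: "qtransport L A (qbar f) = qbar (qtransport L A f)"
  by (auto simp: qtransport_def qbar_def fun_eq_iff)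

lemma qtransport_support:
  assumes "inj_on L A" "f \<in> qsupported A"
  shows "{q. qtransport L A f q \<noteq> 0} = (\<lambda>(a, k). (L a, - k)) ` {p. f p \<noteq> 0}"
proof (intro set_eqI iffI)
  fix q assume "q \<in> {q. qtransport L A f q \<noteq> 0}"
  then obtain a k where "q = (L a, k)" "a \<in> A" "f (a, - k) \<noteq> 0"
    using assms(1) by (cases q) (auto simp: qtransport_def split: if_splits)
  then show "q \<in> (\<lambda>(a, k). (L a, - k)) ` {p. f p \<noteq> 0}"
    by (auto intro!: image_eqI[of _ _ "(a, - k)"])
next
  fix q assume "q \<in> (\<lambda>(a, k). (L a, - k)) ` {p. f p \<noteq> 0}"
  then show "q \<in> {q. qtransport L A f q \<noteq> 0}"
    using assms by (auto simp: qtransport_apply qsupported_def)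
qed

lemma qtransport_qmon:
  assumes "inj_on L A" "a \<in> A"
  shows "qtransport L A (qmon a k) = qmon (L a) (- k)"
  using assms by (auto simp: qtransport_def qmon_def fun_eq_iff)

lemma qtransport_mem:
  assumes "inj_on L A" "f \<in> qsupported A"
  shows "qtransport L A f \<in> qsupported (L ` A)"
proof -
  have "finite {q. qtransport L A f q \<noteq> 0}"
    unfolding qtransport_support[OF assms] using assms(2) by (simp add: qsupported_def qfin_def)
  moreover have "b \<in> L ` A" if "qtransport L A f (b, k) \<noteq> 0" for b k
    using that by (auto simp: qtransport_def split: if_splits)
  ultimately show ?thesis unfolding qsupported_def qfin_def by blast
qed

lemma qtransport_image:
  fixes L :: "'g \<Rightarrow> 'h"
  assumes "inj_on L A"
  shows "qtransport L A ` qsupported A = qsupported (L ` A)"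
proof
  show "qtransport L A ` qsupported A \<subseteq> qsupported (L ` A)"
    using qtransport_mem[OF assms] by blast
  show "qsupported (L ` A) \<subseteq> qtransport L A ` qsupported A"
  proof
    fix g assume g: "g \<in> qsupported (L ` A)"
    define f where "f = (\<lambda>(a, k). if a \<in> A then g (L a, - k) else 0)"
    have "{p. f p \<noteq> 0} \<subseteq> (\<lambda>(b, k). (inv_into A L b, - k)) ` {q. g q \<noteq> 0}"
    proof
      fix p assume p: "p \<in> {p. f p \<noteq> 0}"
      obtain a k where ak: "p = (a, k)" by (cases p)
      then have "a \<in> A" "g (L a, - k) \<noteq> 0" using p by (auto simp: f_def split: if_splits)
      then show "p \<in> (\<lambda>(b, k). (inv_into A L b, - k)) ` {q. g q \<noteq> 0}"
        using assms ak by (intro image_eqI[of _ _ "(L a, - k)"]) auto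
    qed
    moreover have "finite {q. g q \<noteq> 0}" using g by (simp add: qsupported_def qfin_def)
    ultimately have "qfin f" unfolding qfin_def by (meson finite_imageI finite_subset)
    then have "f \<in> qsupported A" by (auto simp: qsupported_def f_def split: if_splits)
    moreover have "qtransport L A f = g"
    proof
      fix q :: "'h \<times> int"
      obtain b k where q: "q = (b, k)" by (cases q)
      show "qtransport L A f q = g q"
      proof (cases "b \<in> L ` A")
        case True
        then show ?thesis using assms q by (auto simp: qtransport_def f_def)
      next
        case False
        then have "g q = 0" using g q unfolding qsupported_def by blast
        then show ?thesis using False q by (simp add: qtransport_def)
      qed
    qed
    ultimately show "g \<in> qtransport L A ` qsupported A" by blast
  qed
qed

lemma qtransport_inj:
  fixes L :: "'g \<Rightarrow> 'h"
  assumes "inj_on L A"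
  shows "inj_on (qtransport L A) (qsupported A)"
proof (rule inj_onI)
  fix f g assume fg: "f \<in> qsupported A" "g \<in> qsupported A" "qtransport L A f = qtransport L A g"
  show "f = g"
  proof
    fix p :: "'g \<times> int"
    obtain a k where p: "p = (a, k)" by (cases p)
    show "f p = g p"
    proof (cases "a \<in> A")
      case True
      then show ?thesis
        using qtransport_apply[OF assms True, of _ "- k"] fg(3) p by (metis minus_minus)
    next
      case False
      then have "f p = 0" "g p = 0" using fg p unfolding qsupported_def by blast+
      then show ?thesis by simp
    qed
  qed
qed

text \<open>Inverting the parameter compensates the minus sign between the two forms, and
  injectivity on \<open>A\<close> keeps distinct exponents from merging in the product.\<close>

lemma qtransport_qmult:
  fixes L :: "'g::ab_group_add \<Rightarrow> 'h::ab_group_add"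
  assumes inj: "inj_on L A" and f: "f \<in> qsupported A" and g: "g \<in> qsupported A"
    and closed: "\<And>a b. a \<in> A \<Longrightarrow> b \<in> A \<Longrightarrow> a + b \<in> A"
    and add: "\<And>a b. a \<in> A \<Longrightarrow> b \<in> A \<Longrightarrow> L (a + b) = L a + L b"
    and form: "\<And>a b. a \<in> A \<Longrightarrow> b \<in> A \<Longrightarrow> N' (L a) (L b) = - N a b"
  shows "qtransport L A (qmult N f g) = qmult N' (qtransport L A f) (qtransport L A g)"
proof
  fix x :: "'h \<times> int"
  obtain c m where x: "x = (c, m)" by (cases x)
  define \<theta> where "\<theta> = (\<lambda>(a, k). (L a, - k :: int))"
  define P Q where "P = {p. f p \<noteq> 0}" and "Q = {q. g q \<noteq> 0}"
  have PA: "fst p \<in> A" if "p \<in> P" for p using that f by (cases p) (auto simp: P_def qsupported_def)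
  have QA: "fst q \<in> A" if "q \<in> Q" for q using that g by (cases q) (auto simp: Q_def qsupported_def)
  have inj': "inj_on \<theta> R" if "\<And>p. p \<in> R \<Longrightarrow> fst p \<in> A" for R
  proof (rule inj_onI)
    fix p q assume "p \<in> R" "q \<in> R" "\<theta> p = \<theta> q"
    then have "L (fst p) = L (fst q)" "snd p = snd q" by (auto simp: \<theta>_def split: prod.splits)
    then show "p = q" using inj_onD[OF inj] that \<open>p \<in> R\<close> \<open>q \<in> R\<close> by (simp add: prod_eq_iff)
  qed
  have supp: "{p. qtransport L A f p \<noteq> 0} = \<theta> ` P" "{q. qtransport L A g q \<noteq> 0} = \<theta> ` Q"
    unfolding \<theta>_def P_def Q_def using qtransport_support[OF inj] f g by blast+
  have val: "qtransport L A h (\<theta> p) = h p" if "fst p \<in> A" for p h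
    using that qtransport_apply[OF inj] by (cases p) (auto simp: \<theta>_def)
  have *: "qmult N' (qtransport L A f) (qtransport L A g) x =
     (\<Sum>p\<in>P. \<Sum>q\<in>Q. if L (fst p + fst q) = c \<and> snd p + snd q + N (fst p) (fst q) = - m
        then f p * g q else 0)"
  proof -
    have "qmult N' (qtransport L A f) (qtransport L A g) x =
     (\<Sum>p\<in>P. \<Sum>q\<in>Q. if fst (\<theta> p) + fst (\<theta> q) = c \<and> snd (\<theta> p) + snd (\<theta> q) + N' (fst (\<theta> p)) (fst (\<theta> q)) = m
        then qtransport L A f (\<theta> p) * qtransport L A g (\<theta> q) else 0)"
      unfolding qmult_def x supp prod.case
      by (simp add: sum.reindex[OF inj'[OF PA]] sum.reindex[OF inj'[OF QA]] o_def)
    also have "\<dots> = (\<Sum>p\<in>P. \<Sum>q\<in>Q. if L (fst p + fst q) = c \<and> snd p + snd q + N (fst p) (fst q) = - m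
        then f p * g q else 0)"
    proof (intro sum.cong refl)
      fix p q assume pq: "p \<in> P" "q \<in> Q"
      have "fst (\<theta> p) = L (fst p)" "fst (\<theta> q) = L (fst q)" "snd (\<theta> p) = - snd p" "snd (\<theta> q) = - snd q"
        by (simp_all add: \<theta>_def split: prod.splits)
      then show "(if fst (\<theta> p) + fst (\<theta> q) = c \<and> snd (\<theta> p) + snd (\<theta> q) + N' (fst (\<theta> p)) (fst (\<theta> q)) = m
          then qtransport L A f (\<theta> p) * qtransport L A g (\<theta> q) else 0) =
        (if L (fst p + fst q) = c \<and> snd p + snd q + N (fst p) (fst q) = - m then f p * g q else 0)"
        using PA[OF pq(1)] QA[OF pq(2)] by (auto simp: val add form)
    qed
    finally show ?thesis .
  qed
  show "qtransport L A (qmult N f g) x = qmult N' (qtransport L A f) (qtransport L A g) x"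
  proof (cases "c \<in> L ` A")
    case True
    then obtain a where a: "a \<in> A" "c = L a" by blast
    have "qtransport L A (qmult N f g) x = qmult N f g (a, - m)"
      unfolding x a(2) by (rule qtransport_apply[OF inj a(1)])
    also have "\<dots> = (\<Sum>p\<in>P. \<Sum>q\<in>Q. if fst p + fst q = a \<and> snd p + snd q + N (fst p) (fst q) = - m
        then f p * g q else 0)"
      by (simp add: qmult_def P_def Q_def)
    also have "\<dots> = (\<Sum>p\<in>P. \<Sum>q\<in>Q. if L (fst p + fst q) = c \<and> snd p + snd q + N (fst p) (fst q) = - m
        then f p * g q else 0)"
    proof (intro sum.cong refl)
      fix p q assume "p \<in> P" "q \<in> Q"
      then have "L (fst p + fst q) = c \<longleftrightarrow> fst p + fst q = a"
        using inj_on_eq_iff[OF inj closed[OF PA QA] a(1)] a(2) by simp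
      then show "(if fst p + fst q = a \<and> snd p + snd q + N (fst p) (fst q) = - m then f p * g q else 0) =
        (if L (fst p + fst q) = c \<and> snd p + snd q + N (fst p) (fst q) = - m then f p * g q else 0)" by simp
    qed
    finally show ?thesis using * by simp
  next
    case False
    then have "L (fst p + fst q) \<noteq> c" if "p \<in> P" "q \<in> Q" for p q
      using closed[OF PA[OF that(1)] QA[OF that(2)]] by blast
    then show ?thesis using False * x by (simp add: qtransport_def)
  qed
qed

lemma quadruple_sum:
  fixes a b :: "nat \<Rightarrow> int"
  shows "(\<Sum>k\<in>A. \<Sum>l\<in>A. (\<Sum>s\<in>A. I k s * a s) * (\<Sum>t\<in>A. I l t * b t) * g k l)
    = (\<Sum>s\<in>A. \<Sum>t\<in>A. a s * b t * (\<Sum>k\<in>A. \<Sum>l\<in>A. I k s * I l t * g k l))"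
proof -
  have "(\<Sum>k\<in>A. \<Sum>l\<in>A. (\<Sum>s\<in>A. I k s * a s) * (\<Sum>t\<in>A. I l t * b t) * g k l)
      = (\<Sum>k\<in>A. \<Sum>l\<in>A. \<Sum>s\<in>A. \<Sum>t\<in>A. a s * b t * (I k s * I l t * g k l))"
    unfolding sum_product sum_distrib_right by (intro sum.cong refl) (simp add: sum_distrib_left mult_ac)
  also have "\<dots> = (\<Sum>k\<in>A. \<Sum>s\<in>A. \<Sum>l\<in>A. \<Sum>t\<in>A. a s * b t * (I k s * I l t * g k l))"
    by (rule sum.cong[OF refl], rule sum.swap)
  also have "\<dots> = (\<Sum>s\<in>A. \<Sum>k\<in>A. \<Sum>l\<in>A. \<Sum>t\<in>A. a s * b t * (I k s * I l t * g k l))"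
    by (rule sum.swap)
  also have "\<dots> = (\<Sum>s\<in>A. \<Sum>k\<in>A. \<Sum>t\<in>A. \<Sum>l\<in>A. a s * b t * (I k s * I l t * g k l))"
    by (rule sum.cong[OF refl], rule sum.cong[OF refl], rule sum.swap)
  also have "\<dots> = (\<Sum>s\<in>A. \<Sum>t\<in>A. \<Sum>k\<in>A. \<Sum>l\<in>A. a s * b t * (I k s * I l t * g k l))"
    by (rule sum.cong[OF refl], rule sum.swap)
  finally show ?thesis by (simp add: sum_distrib_left)
qed

section \<open>The isomorphism\<close>

context twisted_word begin

abbreviation "vertex \<equiv> \<lambda>k. ovl n (pos k)"
abbreviation "S \<equiv> barItw n \<xi> gt"

section \<open>The map of exponent lattices\<close>

lemma vertex_inj: "inj_on vertex {1..ell}"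
proof (rule inj_onI)
  fix k l assume kl: "k \<in> {1..ell}" "l \<in> {1..ell}" "vertex k = vertex l"
  then have "pos k = (w k, ht k)" "pos l = (w l, ht k)" "fld (w k) = fld (w l)"
    by (auto simp: fold_w_pos prod_eq_iff)
  then have "w k = w l" using folded_position_inj pos_mem[OF kl(1)] pos_mem[OF kl(2)] by metis
  then show "k = l" using pos_inj[OF kl(1,2)] \<open>pos l = (w l, ht k)\<close> by (simp add: prod_eq_iff)
qed

lemma vertex_image: "vertex ` {1..ell} = S"
proof -
  have "pos ` {1..ell} = T" using pos_bij by (simp add: bij_betw_def)
  then show ?thesis by (metis barItw_def image_image)
qed

lemma finite_S: "finite S"
  unfolding vertex_image[symmetric] by simp

text \<open>The matrix of the exponent map: the unit vector at s goes to the sum of all vertices of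
  its column placed no later than s.\<close>

definition above :: "nat \<Rightarrow> nat \<Rightarrow> int" where
  "above k s = (if k \<le> s \<and> w k = w s then 1 else 0)"

definition lattice_map :: "texp \<Rightarrow> yexp" where
  "lattice_map a = (\<Sum>k\<in>{1..ell}. Poly_Mapping.single (vertex k)
     (\<Sum>s\<in>{1..ell}. above k s * Poly_Mapping.lookup a s))"

abbreviation "A \<equiv> {a :: texp. Poly_Mapping.keys a \<subseteq> {1..ell}}"

lemma lookup_lattice_map:
  assumes "k \<in> {1..ell}"
  shows "Poly_Mapping.lookup (lattice_map a) (vertex k) = (\<Sum>s\<in>{1..ell}. above k s * Poly_Mapping.lookup a s)"
proof -
  have "Poly_Mapping.lookup (lattice_map a) (vertex k)
    = (\<Sum>l\<in>{1..ell}. if l = k then \<Sum>s\<in>{1..ell}. above l s * Poly_Mapping.lookup a s else 0)"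
    unfolding lattice_map_def lookup_sum lookup_single when_def
    by (intro sum.cong refl) (use assms inj_on_eq_iff[OF vertex_inj] in auto)
  then show ?thesis using assms by simp
qed

lemma keys_lattice_map: "Poly_Mapping.keys (lattice_map a) \<subseteq> S"
proof
  fix x assume "x \<in> Poly_Mapping.keys (lattice_map a)"
  then have "(\<Sum>k\<in>{1..ell}. Poly_Mapping.lookup (Poly_Mapping.single (vertex k)
     (\<Sum>s\<in>{1..ell}. above k s * Poly_Mapping.lookup a s)) x) \<noteq> 0"
    by (simp add: in_keys_iff lattice_map_def lookup_sum)
  then obtain k where "k \<in> {1..ell}" "x = vertex k"
    by (elim sum.not_neutral_contains_not_neutral) (auto simp: lookup_single when_def split: if_splits)
  then show "x \<in> S" using vertex_image by blast
qed

lemma lattice_map_add: "lattice_map (a + b) = lattice_map a + lattice_map b"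
  by (simp add: lattice_map_def lookup_add distrib_left sum.distrib single_add)

lemma exponents_add: "a \<in> A \<Longrightarrow> b \<in> A \<Longrightarrow> a + b \<in> A"
  using keys_add[of a b] by blast

text \<open>Coordinate k of the image is a_k plus a combination of a_s with s > k, so the
  coordinates are recovered from the last position backwards.\<close>

lemma lattice_map_inj: "inj_on lattice_map A"
proof (rule inj_onI)
  fix a b assume ab: "a \<in> A" "b \<in> A" "lattice_map a = lattice_map b"
  have eq: "Poly_Mapping.lookup a k = Poly_Mapping.lookup b k" if "k \<in> {1..ell}" for k
    using that
  proof (induction "ell - k" arbitrary: k rule: less_induct)
    case less
    have split: "(\<Sum>s\<in>{1..ell}. above k s * Poly_Mapping.lookup c s)
      = Poly_Mapping.lookup c k + (\<Sum>s\<in>{k<..ell}. above k s * Poly_Mapping.lookup c s)" for c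
    proof -
      have "(\<Sum>s\<in>{1..ell}. above k s * Poly_Mapping.lookup c s)
        = (\<Sum>s\<in>insert k {k<..ell}. above k s * Poly_Mapping.lookup c s)"
        by (rule sum.mono_neutral_right) (use less.prems in \<open>auto simp: above_def\<close>)
      then show ?thesis by (simp add: above_def)
    qed
    have "(\<Sum>s\<in>{k<..ell}. above k s * Poly_Mapping.lookup a s) = (\<Sum>s\<in>{k<..ell}. above k s * Poly_Mapping.lookup b s)"
      by (intro sum.cong refl) (use less in auto)
    then show ?case
      using lookup_lattice_map[OF less.prems, of a] lookup_lattice_map[OF less.prems, of b] ab(3)
      unfolding split by simp
  qed
  show "a = b"
  proof (rule poly_mapping_eqI)
    fix k
    show "Poly_Mapping.lookup a k = Poly_Mapping.lookup b k"
    proof (cases "k \<in> {1..ell}")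
      case False
      then have "k \<notin> Poly_Mapping.keys a" "k \<notin> Poly_Mapping.keys b" using ab by auto
      then show ?thesis by (simp add: in_keys_iff)
    qed (rule eq)
  qed
qed

lemma lattice_map_single:
  assumes "k \<in> {1..ell}"
  shows "lattice_map (Poly_Mapping.single k c)
    = (\<Sum>l\<in>{l\<in>{1..k}. w l = w k}. Poly_Mapping.single (vertex l) c)"
proof -
  have "(\<Sum>s\<in>{1..ell}. above l s * Poly_Mapping.lookup (Poly_Mapping.single k c) s) = above l k * c" for l
  proof -
    have "(\<Sum>s\<in>{1..ell}. above l s * Poly_Mapping.lookup (Poly_Mapping.single k c) s)
      = (\<Sum>s\<in>{1..ell}. if s = k then above l s * c else 0)"
      by (intro sum.cong refl) (auto simp: lookup_single when_def)
    then show ?thesis using assms by simp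
  qed
  then have "lattice_map (Poly_Mapping.single k c) = (\<Sum>l\<in>{1..ell}. Poly_Mapping.single (vertex l) (above l k * c))"
    by (simp add: lattice_map_def)
  also have "\<dots> = (\<Sum>l\<in>{l\<in>{1..k}. w l = w k}. Poly_Mapping.single (vertex l) c)"
    by (rule sum.mono_neutral_cong_right) (use assms in \<open>auto simp: above_def\<close>)
  finally show ?thesis .
qed

lemma lattice_map_image: "lattice_map ` A = {b. Poly_Mapping.keys b \<subseteq> S}"
proof
  show "lattice_map ` A \<subseteq> {b. Poly_Mapping.keys b \<subseteq> S}" using keys_lattice_map by blast
  have zero: "0 \<in> lattice_map ` A"
    by (rule image_eqI[of _ _ 0]) (simp_all add: lattice_map_def)
  have plus: "x + y \<in> lattice_map ` A" if "x \<in> lattice_map ` A" "y \<in> lattice_map ` A" for x y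
  proof -
    obtain a b where "a \<in> A" "b \<in> A" "x = lattice_map a" "y = lattice_map b" using \<open>x \<in> _\<close> \<open>y \<in> _\<close> by blast
    then show ?thesis using lattice_map_add exponents_add by (intro image_eqI[of _ _ "a + b"]) auto
  qed
  have sums: "(\<Sum>i\<in>I. f i) \<in> lattice_map ` A" if "finite I" "\<And>i. i \<in> I \<Longrightarrow> f i \<in> lattice_map ` A"
    for I :: "nat set" and f
    using that
  proof (induction I rule: finite_induct)
    case empty
    show ?case unfolding sum.empty by (rule zero)
  next
    case (insert i I)
    show ?case unfolding sum.insert[OF insert.hyps] by (intro plus insert.IH insert.prems) auto
  qed
  \<comment> \<open>A vertex is the image of its unit vector minus the earlier vertices of its
    column, so here the induction runs upwards.\<close>
  have single: "Poly_Mapping.single (vertex k) c \<in> lattice_map ` A" if "k \<in> {1..ell}" for k c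
    using that
  proof (induction k arbitrary: c rule: less_induct)
    case (less k)
    have "lattice_map (Poly_Mapping.single k c) = Poly_Mapping.single (vertex k) c
        + (\<Sum>l\<in>{l\<in>{1..<k}. w l = w k}. Poly_Mapping.single (vertex l) c)"
    proof -
      have "{l\<in>{1..k}. w l = w k} = insert k {l\<in>{1..<k}. w l = w k}" using less.prems by auto
      then show ?thesis unfolding lattice_map_single[OF less.prems] by simp
    qed
    then have "Poly_Mapping.single (vertex k) c = lattice_map (Poly_Mapping.single k c)
        + (\<Sum>l\<in>{l\<in>{1..<k}. w l = w k}. Poly_Mapping.single (vertex l) (- c))"
      by (simp add: single_uminus sum_negf)
    moreover have "lattice_map (Poly_Mapping.single k c) \<in> lattice_map ` A"
      using less.prems by auto
    moreover have "(\<Sum>l\<in>{l\<in>{1..<k}. w l = w k}. Poly_Mapping.single (vertex l) (- c)) \<in> lattice_map ` A"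
      by (rule sums) (use less in auto)
    ultimately show ?case using plus by simp
  qed
  show "{b. Poly_Mapping.keys b \<subseteq> S} \<subseteq> lattice_map ` A"
  proof
    fix b :: yexp assume "b \<in> {b. Poly_Mapping.keys b \<subseteq> S}"
    then have "b = (\<Sum>x\<in>S. Poly_Mapping.single x (Poly_Mapping.lookup b x))"
      by (intro sum_single_lookup[OF finite_S, symmetric]) simp
    also have "\<dots> = (\<Sum>k\<in>{1..ell}. Poly_Mapping.single (vertex k) (Poly_Mapping.lookup b (vertex k)))"
      unfolding vertex_image[symmetric] sum.reindex[OF vertex_inj] o_def ..
    also have "\<dots> \<in> lattice_map ` A" by (rule sums) (use single in auto)
    finally show "b \<in> lattice_map ` A" .
  qed
qed

text \<open>By \<open>LamM_gammaB\<close>, -Lambda is the Gram matrix of gamma on the images of the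
  unit vectors; the rest is bilinearity.\<close>

lemma NY_lattice_map:
  "NY n (lattice_map a) (lattice_map b) = - NT n w a b"
proof -
  have "NY n (lattice_map a) (lattice_map b) = (\<Sum>k\<in>{1..ell}. \<Sum>l\<in>{1..ell}.
      Poly_Mapping.lookup (lattice_map a) (vertex k) * Poly_Mapping.lookup (lattice_map b) (vertex l)
       * gammaB n (vertex k) (vertex l))"
    unfolding NY_superset[OF finite_S keys_lattice_map keys_lattice_map] vertex_image[symmetric]
      sum.reindex[OF vertex_inj] o_def ..
  also have "\<dots> = (\<Sum>k\<in>{1..ell}. \<Sum>l\<in>{1..ell}.
      (\<Sum>s\<in>{1..ell}. above k s * Poly_Mapping.lookup a s) * (\<Sum>t\<in>{1..ell}. above l t * Poly_Mapping.lookup b t)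
       * gammaB n (vertex k) (vertex l))"
    by (intro sum.cong refl) (simp add: lookup_lattice_map)
  also have "\<dots> = (\<Sum>s\<in>{1..ell}. \<Sum>t\<in>{1..ell}. Poly_Mapping.lookup a s * Poly_Mapping.lookup b t *
      (\<Sum>k\<in>{1..ell}. \<Sum>l\<in>{1..ell}. above k s * above l t * gammaB n (vertex k) (vertex l)))"
    by (rule quadruple_sum)
  also have "\<dots> = (\<Sum>s\<in>{1..ell}. \<Sum>t\<in>{1..ell}. Poly_Mapping.lookup a s * Poly_Mapping.lookup b t *
      - LamM n w s t)"
  proof (intro sum.cong refl arg_cong2[where f = "(*)"])
    fix s t assume st: "s \<in> {1..ell}" "t \<in> {1..ell}"
    have "(\<Sum>k\<in>{1..ell}. \<Sum>l\<in>{1..ell}. above k s * above l t * gammaB n (vertex k) (vertex l))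
      = (\<Sum>k\<in>{k\<in>{1..s}. w k = w s}. \<Sum>l\<in>{1..ell}. above k s * above l t * gammaB n (vertex k) (vertex l))"
      by (rule sum.mono_neutral_right) (use st in \<open>auto simp: above_def\<close>)
    also have "\<dots> = (\<Sum>k\<in>{k\<in>{1..s}. w k = w s}. \<Sum>l\<in>{l\<in>{1..t}. w l = w t}. gammaB n (vertex k) (vertex l))"
      by (rule sum.cong[OF refl], rule sum.mono_neutral_cong_right) (use st in \<open>auto simp: above_def\<close>)
    finally show "(\<Sum>k\<in>{1..ell}. \<Sum>l\<in>{1..ell}. above k s * above l t * gammaB n (vertex k) (vertex l))
      = - LamM n w s t"
      using LamM_gammaB[OF st] by simp
  qed
  also have "\<dots> = - NT n w a b" by (simp add: NT_def sum_negf)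
  finally show ?thesis .
qed

section \<open>Upper parts of columns and the monomials assigned to the generators\<close>

lemma column_above:
  assumes "k \<in> {1..ell}"
  shows "l \<in> {1..ell} \<Longrightarrow> w l = w k \<Longrightarrow> l \<le> k \<longleftrightarrow> ht k \<le> ht l"
  using pos_sorted[of l k] pos_sorted[of k l] pos_inj[OF assms, of l] assms
  by (cases l k rule: linorder_cases) (auto simp: prod_eq_iff)

lemma column_segment:
  assumes "k \<in> {1..ell}"
  obtains Q :: nat where "{r. (w k, r) \<in> T \<and> ht k \<le> r} = (\<lambda>q. ht k + cstep (w k) * int q) ` {0..Q}"
proof -
  have T: "(w k, ht k) \<in> T" using pos_mem[OF assms] by simp
  then obtain q where q: "ctop (w k) - ht k = cstep (w k) * q" unfolding hatItw_iff by (auto elim: dvdE)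
  have c: "cstep (w k) > 0" by (rule step_pos)
  have "{r. (w k, r) \<in> T \<and> ht k \<le> r} = (\<lambda>q. ht k + cstep (w k) * int q) ` {0..nat q}"
  proof (intro set_eqI iffI)
    fix r assume r: "r \<in> {r. (w k, r) \<in> T \<and> ht k \<le> r}"
    then obtain p where p: "ctop (w k) - r = cstep (w k) * p" unfolding hatItw_iff by (auto elim: dvdE)
    have "0 \<le> cstep (w k) * p" "cstep (w k) * p \<le> cstep (w k) * q" using r p q by (auto simp: hatItw_iff)
    then have "0 \<le> p" "p \<le> q" using c by (auto simp: zero_le_mult_iff)
    moreover have "r = ht k + cstep (w k) * (q - p)" using p q by (simp add: algebra_simps)
    ultimately show "r \<in> (\<lambda>q. ht k + cstep (w k) * int q) ` {0..nat q}"
      by (intro image_eqI[of _ _ "nat (q - p)"]) auto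
  next
    fix r assume "r \<in> (\<lambda>q. ht k + cstep (w k) * int q) ` {0..nat q}"
    then obtain p where p: "r = ht k + cstep (w k) * int p" "p \<in> {0..nat q}" by (rule imageE)
    have "ht k \<le> ctop (w k)" using T unfolding hatItw_iff by blast
    then have "0 \<le> cstep (w k) * q" using q by simp
    then have "0 \<le> q" using c by (simp add: zero_le_mult_iff)
    then have "cstep (w k) * int p \<le> cstep (w k) * q" using p(2) c by simp
    then have "r \<le> ctop (w k)" using p q by simp
    moreover have "ctop (w k) - r = cstep (w k) * (q - int p)" using p q by (simp add: algebra_simps)
    moreover have "ht k \<le> r" using p(1) c by simp
    moreover have "clow (w k) < r" using T calculation(3) unfolding hatItw_iff by linarith
    ultimately have "(w k, r) \<in> T" using T unfolding hatItw_iff by simp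
    with \<open>ht k \<le> r\<close> show "r \<in> {r. (w k, r) \<in> T \<and> ht k \<le> r}" by simp
  qed
  then show thesis using that by blast
qed

text \<open>Three descriptions of the upper part of a column are matched: the positions up to k with
  the same letter, the vertices at or above height r, and the progression from r in steps 2 r_i with
  k(i, r) terms.\<close>

lemma lattice_map_unit:
  assumes "k \<in> {1..ell}"
  shows "lattice_map (Poly_Mapping.single k 1) = (\<Sum>x\<leftarrow>mlist n (fst (vertex k)) (snd (vertex k))
     (kk n \<xi> gt (vertex k)). Poly_Mapping.single x 1)"
proof -
  define i r c where "i = fld (w k)" and "r = ht k" and "c = cstep (w k)"
  have v: "vertex k = (i, r)" by (simp add: fold_w_pos i_def r_def)
  have wk: "w k \<in> {1..<2*n}" using letters assms by blast
  have T: "(w k, r) \<in> T" using pos_mem[OF assms] by (simp add: r_def)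
  have c: "c = 2 * rB n i" "c > 0" unfolding c_def i_def by (rule col_step_rB[OF wk], rule step_pos)
  obtain Q where Q: "{r'. (w k, r') \<in> T \<and> r \<le> r'} = (\<lambda>q. r + c * int q) ` {0..Q}"
    using column_segment[OF assms] unfolding r_def c_def .
  have inj: "inj (\<lambda>q. r + c * int q)" using c by (auto intro!: injI)
  \<comment> \<open>The count k(i, r) is taken in the folded set, where two columns share row i.
    Steps of 2 r_i preserve the residue class and thus never leave the column of k.\<close>
  have same: "\<kappa> = w k" if "(\<kappa>, r') \<in> T" "fld \<kappa> = i" "r' - r = c * int m" for \<kappa> r' m
  proof (rule folded_lattice_inj[of _ _ r'])
    have "c dvd (ctop (w k) - r) - c * int m"
      by (rule dvd_diff) (use T in \<open>simp_all add: hatItw_iff c_def\<close>)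
    then show "cstep (w k) dvd ctop (w k) - r'" using that(3) by (simp add: c_def algebra_simps)
  qed (use that wk in \<open>auto simp: hatItw_iff i_def\<close>)
  have "{r'. (i, r') \<in> S \<and> (\<exists>m::nat. r' - r = 2 * rB n i * int m)} = {r'. (w k, r') \<in> T \<and> r \<le> r'}"
  proof (intro set_eqI iffI)
    fix r' assume "r' \<in> {r'. (i, r') \<in> S \<and> (\<exists>m::nat. r' - r = 2 * rB n i * int m)}"
    then obtain m where m: "(i, r') \<in> S" "r' - r = c * int m" using c by auto
    from m(1) obtain \<kappa> where k: "(\<kappa>, r') \<in> T" "fld \<kappa> = i"
      unfolding barItw_def by (auto simp: ovl_eq)
    have "0 \<le> c * int m" using c(2) by simp
    then show "r' \<in> {r'. (w k, r') \<in> T \<and> r \<le> r'}" using same[OF k m(2)] k m by simp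
  next
    fix r' assume r': "r' \<in> {r'. (w k, r') \<in> T \<and> r \<le> r'}"
    then obtain q where "r' = r + c * int q" unfolding Q by blast
    moreover have "(i, r') \<in> S" using r' unfolding barItw_def i_def
      by (auto intro!: image_eqI[of _ _ "(w k, r')"] simp: ovl_eq)
    ultimately show "r' \<in> {r'. (i, r') \<in> S \<and> (\<exists>m::nat. r' - r = 2 * rB n i * int m)}"
      using c by auto
  qed
  then have kk: "kk n \<xi> gt (i, r) = Suc Q"
    unfolding kk_def prod.case Q by (simp add: card_image[OF inj_on_subset[OF inj]])
  have ml: "mlist n i r (Suc Q) = map (\<lambda>q. (i, r + c * int q)) [0..<Suc Q]"
    unfolding mlist_def by (rule nth_equalityI) (auto simp: c simp del: upt_Suc)
  have "(\<Sum>x\<leftarrow>mlist n i r (Suc Q). Poly_Mapping.single x (1::int))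
     = (\<Sum>x\<in>(\<lambda>q. (i, r + c * int q)) ` {0..Q}. Poly_Mapping.single x 1)"
  proof -
    have "distinct (mlist n i r (Suc Q))"
      unfolding ml distinct_map using c by (auto intro!: inj_onI)
    moreover have "set (mlist n i r (Suc Q)) = (\<lambda>q. (i, r + c * int q)) ` {0..Q}"
      unfolding ml set_map by (simp only: set_upt atLeastLessThanSuc_atLeastAtMost)
    ultimately show ?thesis by (simp add: sum_list_distinct_conv_sum_set)
  qed
  also have "(\<lambda>q. (i, r + c * int q)) ` {0..Q} = vertex ` {l\<in>{1..k}. w l = w k}"
  proof -
    have "(\<lambda>q. (i, r + c * int q)) ` {0..Q} = Pair i ` {r'. (w k, r') \<in> T \<and> r \<le> r'}"
      unfolding Q image_image ..
    also have "\<dots> = vertex ` {l\<in>{1..k}. w l = w k}"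
    proof (intro set_eqI iffI)
      fix x assume "x \<in> Pair i ` {r'. (w k, r') \<in> T \<and> r \<le> r'}"
      then obtain r' where r': "x = (i, r')" "(w k, r') \<in> T" "r \<le> r'" by blast
      then obtain l where l: "l \<in> {1..ell}" "pos l = (w k, r')" using pos_surj by blast
      then have "l \<le> k" using column_above[OF assms l(1)] r' by (simp add: r_def)
      then show "x \<in> vertex ` {l\<in>{1..k}. w l = w k}"
        using l r' by (intro image_eqI[of _ _ l]) (auto simp: ovl_eq i_def)
    next
      fix x assume "x \<in> vertex ` {l\<in>{1..k}. w l = w k}"
      then obtain l where l: "l \<in> {1..k}" "w l = w k" "x = vertex l" by blast
      then have "l \<in> {1..ell}" using assms by auto
      moreover have "pos l = (w k, ht l)" using l(2) by (simp add: prod_eq_iff)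
      ultimately have "(w k, ht l) \<in> T" "ht k \<le> ht l"
        using pos_mem[of l] column_above[OF assms, of l] l(1,2) by simp_all
      then show "x \<in> Pair i ` {r'. (w k, r') \<in> T \<and> r \<le> r'}"
        using l by (auto simp: fold_w_pos i_def r_def)
    qed
    finally show ?thesis .
  qed
  also have "(\<Sum>x\<in>vertex ` {l\<in>{1..k}. w l = w k}. Poly_Mapping.single x (1::int))
    = (\<Sum>l\<in>{l\<in>{1..k}. w l = w k}. Poly_Mapping.single (vertex l) 1)"
    using sum.reindex[OF inj_on_subset[OF vertex_inj]] assms by (subst sum.reindex[OF inj_on_subset[OF vertex_inj]]) auto
  finally show ?thesis unfolding v kk fst_conv snd_conv lattice_map_single[OF assms] by simp
qed

lemma T_elems_eq: "T_elems n = qsupported A"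
  by (simp add: T_elems_def qsupported_def)

definition iso :: "texp qtor \<Rightarrow> yexp qtor" where
  "iso = qtransport lattice_map A"

lemma iso_properties:
  "(\<forall>f\<in>T_elems n. \<forall>g\<in>T_elems n.
      iso (qadd f g) = qadd (iso f) (iso g) \<and>
      iso (qmult (NT n w) f g) = qmult (NY n) (iso f) (iso g)) \<and>
   iso (qmon 0 0) = qmon 0 0 \<and>
   inj_on iso (T_elems n) \<and>
   iso ` T_elems n = Ysubalg n (barItw n \<xi> gt) \<and>
   iso (qmon 0 1) = qmon 0 (-1) \<and>
   iso (qmon 0 (-1)) = qmon 0 1 \<and>
   (\<forall>k\<in>{1..ell}. iso (qmon (Poly_Mapping.single k 1) 0) =
      (let x = ovl n (pos k) in underline n (mlist n (fst x) (snd x) (kk n \<xi> gt x)))) \<and>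
   (\<forall>f\<in>T_elems n. iso (qbar f) = qbar (iso f))"
proof -
  have zero: "lattice_map 0 = 0" by (simp add: lattice_map_def)
  have mon: "iso (qmon 0 k) = qmon 0 (- k)" for k
    unfolding iso_def using qtransport_qmon[OF lattice_map_inj, of 0 k] zero by simp
  have gen: "iso (qmon (Poly_Mapping.single k 1) 0) =
      (let x = ovl n (pos k) in underline n (mlist n (fst x) (snd x) (kk n \<xi> gt x)))" if "k \<in> {1..ell}" for k
    unfolding iso_def Let_def underline_eq lattice_map_unit[OF that, symmetric]
    using qtransport_qmon[OF lattice_map_inj, of "Poly_Mapping.single k 1" 0] that by simp
  have mult: "iso (qmult (NT n w) f g) = qmult (NY n) (iso f) (iso g)"
    if "f \<in> T_elems n" "g \<in> T_elems n" for f g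
    unfolding iso_def
  proof (rule qtransport_qmult[OF lattice_map_inj])
    show "f \<in> qsupported A" "g \<in> qsupported A" using that unfolding T_elems_eq .
  qed (rule exponents_add lattice_map_add NY_lattice_map; assumption)+
  show ?thesis
  proof (intro conjI ballI)
    show "iso (qadd f g) = qadd (iso f) (iso g)" for f g
      unfolding iso_def by (rule qtransport_qadd)
    show "inj_on iso (T_elems n)"
      unfolding iso_def T_elems_eq by (rule qtransport_inj[OF lattice_map_inj])
    show "iso ` T_elems n = Ysubalg n (barItw n \<xi> gt)"
      unfolding iso_def T_elems_eq Ysubalg_eq qtransport_image[OF lattice_map_inj] lattice_map_image ..
    show "iso (qbar f) = qbar (iso f)" for f
      unfolding iso_def by (rule qtransport_qbar)
    show "iso (qmon 0 0) = qmon 0 0" "iso (qmon 0 1) = qmon 0 (- 1)" "iso (qmon 0 (- 1)) = qmon 0 1"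
      using mon[of 0] mon[of 1] mon[of "- 1"] by simp_all
  next
    fix f g assume "f \<in> T_elems n" "g \<in> T_elems n"
    then show "iso (qmult (NT n w) f g) = qmult (NY n) (iso f) (iso g)" by (rule mult)
  next
    fix k assume "k \<in> {1..ell}"
    then show "iso (qmon (Poly_Mapping.single k 1) 0) =
      (let x = ovl n (pos k) in underline n (mlist n (fst x) (snd x) (kk n \<xi> gt x)))" by (rule gen)
  qed
qed

end

theorem theorem6p3:
  fixes n :: nat and arr :: "nat \<Rightarrow> nat \<Rightarrow> bool" and \<xi> :: "nat \<Rightarrow> int"
    and gt :: bool and pos :: "nat \<Rightarrow> nat \<times> int"
  assumes "n \<ge> 2"
    and "typeA_quiver (2 * n - 2) arr"
    and "height_fn arr \<xi>"
    and "bij_betw pos {1..ellB n} (hatItw n \<xi> gt)"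
    and "\<forall>s t. 1 \<le> s \<longrightarrow> s < t \<longrightarrow> t \<le> ellB n \<longrightarrow> snd (pos t) \<le> snd (pos s)"
  shows "\<exists>\<Phi> :: texp qtor \<Rightarrow> yexp qtor.
     (\<forall>f\<in>T_elems n. \<forall>g\<in>T_elems n.
         \<Phi> (qadd f g) = qadd (\<Phi> f) (\<Phi> g) \<and>
         \<Phi> (qmult (NT n (\<lambda>s. fst (pos s))) f g) = qmult (NY n) (\<Phi> f) (\<Phi> g)) \<and>
     \<Phi> (qmon 0 0) = qmon 0 0 \<and>
     inj_on \<Phi> (T_elems n) \<and>
     \<Phi> ` T_elems n = Ysubalg n (barItw n \<xi> gt) \<and>
     \<Phi> (qmon 0 1) = qmon 0 (-1) \<and>
     \<Phi> (qmon 0 (-1)) = qmon 0 1 \<and>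
     (\<forall>k\<in>{1..ellB n}.
        \<Phi> (qmon (Poly_Mapping.single k 1) 0) =
          (let x = ovl n (pos k) in
           underline n (mlist n (fst x) (snd x) (kk n \<xi> gt x)))) \<and>
     (\<forall>f\<in>T_elems n. \<Phi> (qbar f) = qbar (\<Phi> f))"
proof -
  interpret twisted_word n \<xi> gt pos
    using assms height_step by unfold_locales blast+
  show ?thesis by (rule exI[of _ iso]) (rule iso_properties)
qed

end
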